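(* There is a deterministic algorithm which, given a graph $G=(V,E)$ on $n$ vertices with maximum degree $d$, a vector $\vec p\in(0,1)^V$ and $\alpha\in(0,1]$, runs in time $(n/\alpha)^{O(\sqrt{n/\alpha}\log d)}$ and decides whether $\vec p\in\mathcal{S}_G$ or $(1+\alpha)\vec p\notin\mathcal{S}_G$ (i.e., it outputs one of these two statements, and the statement it outputs is true).
   Context: For a graph $G=(V,E)$ and $\vec x\in\mathbb{C}^V$, the independence polynomial is $Z_G(\vec x)=\sum_{I}\prod_{v\in I}x_v$ over all independent sets $I$ of $G$. The Shearer region is $\mathcal{S}_G=\{\vec p\in[0,1]^V : Z_G(\vec z)\neq 0 \text{ for all } \vec z\in\mathbb{C}^V \text{ with } |z_v|\le p_v\ \forall v\}$. Equivalently, for $\vec p\in(0,1)^V$: $\vec p\in\mathcal{S}_G$ iff $\breve q_S(\vec p)>0$ for all $S\subseteq V$, where $\breve q_S(\vec p)=\sum_{I\subseteq S,\ I\text{ independent in }G}(-1)^{|I|}\prod_{v\in I}p_v$.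
   Formalization: Time is counted in exact unit-cost real arithmetic; for maximum degree d ≤ 1, where log d is zero or undefined and the stated bound fails, log d is read as log 2 and the base n/α as max(2, n/α). *)

theory Defs
  imports Complex_Main
begin

section \<open>Graphs, the independence polynomial, and the Shearer region\<close>

definition simple_graph :: "'a set \<Rightarrow> 'a set set \<Rightarrow> bool" where
  "simple_graph V E \<longleftrightarrow> finite V \<and> (\<forall>e\<in>E. e \<subseteq> V \<and> card e = 2)"

definition vertex_degree :: "'a set set \<Rightarrow> 'a \<Rightarrow> nat" where
  "vertex_degree E v = card {e \<in> E. v \<in> e}"

definition max_degree :: "'a set \<Rightarrow> 'a set set \<Rightarrow> nat" where
  "max_degree V E = Max (vertex_degree E ` V)"

definition indep_sets :: "'a set \<Rightarrow> 'a set set \<Rightarrow> 'a set set" where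
  "indep_sets V E = {I. I \<subseteq> V \<and> (\<forall>u\<in>I. \<forall>v\<in>I. {u, v} \<notin> E)}"

definition indep_poly :: "'a set \<Rightarrow> 'a set set \<Rightarrow> ('a \<Rightarrow> complex) \<Rightarrow> complex" where
  "indep_poly V E x = (\<Sum>I\<in>indep_sets V E. \<Prod>v\<in>I. x v)"

text \<open>Vectors indexed by \<open>V\<close> are functions on the whole vertex type; only their values on \<open>V\<close>
  matter.\<close>

definition shearer_region :: "'a set \<Rightarrow> 'a set set \<Rightarrow> ('a \<Rightarrow> real) set" where
  "shearer_region V E =
     {p. (\<forall>v\<in>V. 0 \<le> p v \<and> p v \<le> 1) \<and>
         (\<forall>z. (\<forall>v\<in>V. cmod (z v) \<le> p v) \<longrightarrow> indep_poly V E z \<noteq> 0)}"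


section \<open>Real-RAM programs\<close>

text \<open>
  Algorithms on real inputs are programs of a structured real RAM. The memory consists of named
  one-dimensional arrays of natural numbers and of reals (a scalar variable is cell 0 of an array);
  a program mentions finitely many names. Every arithmetic operation, memory access, comparison
  and assignment costs one unit.

  Real arithmetic is exact, with the four field operations and comparison. There is no rounding
  from reals to natural numbers, natural numbers have no multiplication, and the only constants are
  natural numbers. This excludes the known ways of obtaining unrealistic power from unit-cost
  arithmetic (a floor operation, multiplication of indices, real constants encoding advice).
\<close>

type_synonym vname = string

datatype nexp =
    NConst nat
  | NGet vname nexp
  | NAdd nexp nexp
  | NSub nexp nexp

datatype rexp =
    ROfNat nexp
  | RGet vname nexp
  | RAdd rexp rexp
  | RSub rexp rexp
  | RMul rexp rexp
  | RDiv rexp rexp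

datatype bexp =
    NLess nexp nexp
  | RLess rexp rexp
  | BNot bexp
  | BAnd bexp bexp

text \<open>In the assignments the second argument is the index of the cell that is overwritten.\<close>

datatype com =
    Skip
  | NSet vname nexp nexp
  | RSet vname nexp rexp
  | Seq com com
  | Cond bexp com com
  | While bexp com

record state =
  narr :: "vname \<Rightarrow> nat \<Rightarrow> nat"
  rarr :: "vname \<Rightarrow> nat \<Rightarrow> real"

text \<open>Subtraction of natural numbers is truncated, and division by \<open>0\<close> yields \<open>0\<close>.\<close>

primrec nval :: "state \<Rightarrow> nexp \<Rightarrow> nat" where
  "nval s (NConst k) = k"
| "nval s (NGet x i) = narr s x (nval s i)"
| "nval s (NAdd a b) = nval s a + nval s b"
| "nval s (NSub a b) = nval s a - nval s b"

primrec rval :: "state \<Rightarrow> rexp \<Rightarrow> real" where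
  "rval s (ROfNat a) = real (nval s a)"
| "rval s (RGet x i) = rarr s x (nval s i)"
| "rval s (RAdd a b) = rval s a + rval s b"
| "rval s (RSub a b) = rval s a - rval s b"
| "rval s (RMul a b) = rval s a * rval s b"
| "rval s (RDiv a b) = rval s a / rval s b"

primrec bval :: "state \<Rightarrow> bexp \<Rightarrow> bool" where
  "bval s (NLess a b) \<longleftrightarrow> nval s a < nval s b"
| "bval s (RLess a b) \<longleftrightarrow> rval s a < rval s b"
| "bval s (BNot b) \<longleftrightarrow> \<not> bval s b"
| "bval s (BAnd a b) \<longleftrightarrow> bval s a \<and> bval s b"

primrec ncost :: "nexp \<Rightarrow> nat" where
  "ncost (NConst k) = 1"
| "ncost (NGet x i) = 1 + ncost i"
| "ncost (NAdd a b) = 1 + ncost a + ncost b"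
| "ncost (NSub a b) = 1 + ncost a + ncost b"

primrec rcost :: "rexp \<Rightarrow> nat" where
  "rcost (ROfNat a) = 1 + ncost a"
| "rcost (RGet x i) = 1 + ncost i"
| "rcost (RAdd a b) = 1 + rcost a + rcost b"
| "rcost (RSub a b) = 1 + rcost a + rcost b"
| "rcost (RMul a b) = 1 + rcost a + rcost b"
| "rcost (RDiv a b) = 1 + rcost a + rcost b"

primrec bcost :: "bexp \<Rightarrow> nat" where
  "bcost (NLess a b) = 1 + ncost a + ncost b"
| "bcost (RLess a b) = 1 + rcost a + rcost b"
| "bcost (BNot b) = 1 + bcost b"
| "bcost (BAnd a b) = 1 + bcost a + bcost b"

definition nupd :: "vname \<Rightarrow> nat \<Rightarrow> nat \<Rightarrow> state \<Rightarrow> state" where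
  "nupd x i k s = s\<lparr>narr := (narr s)(x := (narr s x)(i := k))\<rparr>"

definition rupd :: "vname \<Rightarrow> nat \<Rightarrow> real \<Rightarrow> state \<Rightarrow> state" where
  "rupd x i r s = s\<lparr>rarr := (rarr s)(x := (rarr s x)(i := r))\<rparr>"

text \<open>\<open>runs c s t s'\<close>: started in \<open>s\<close>, program \<open>c\<close> halts in \<open>s'\<close> after exactly \<open>t\<close> units of time.\<close>

inductive runs :: "com \<Rightarrow> state \<Rightarrow> nat \<Rightarrow> state \<Rightarrow> bool" where
  Skip: "runs Skip s 1 s"
| NSet: "runs (NSet x i a) s (1 + ncost i + ncost a) (nupd x (nval s i) (nval s a) s)"
| RSet: "runs (RSet x i a) s (1 + ncost i + rcost a) (rupd x (nval s i) (rval s a) s)"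
| Seq: "runs c1 s t1 s1 \<Longrightarrow> runs c2 s1 t2 s2 \<Longrightarrow> runs (Seq c1 c2) s (t1 + t2) s2"
| CondTrue: "bval s b \<Longrightarrow> runs c1 s t s' \<Longrightarrow> runs (Cond b c1 c2) s (1 + bcost b + t) s'"
| CondFalse: "\<not> bval s b \<Longrightarrow> runs c2 s t s' \<Longrightarrow> runs (Cond b c1 c2) s (1 + bcost b + t) s'"
| WhileFalse: "\<not> bval s b \<Longrightarrow> runs (While b c) s (1 + bcost b) s"
| WhileTrue: "bval s b \<Longrightarrow> runs c s t1 s1 \<Longrightarrow> runs (While b c) s1 t2 s2 \<Longrightarrow>
    runs (While b c) s (1 + bcost b + t1 + t2) s2"

inductive_cases runs_SkipE: "runs Skip s t s'"
inductive_cases runs_NSetE: "runs (NSet x i a) s t s'"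
inductive_cases runs_RSetE: "runs (RSet x i a) s t s'"
inductive_cases runs_SeqE: "runs (Seq c1 c2) s t s'"
inductive_cases runs_CondE: "runs (Cond b c1 c2) s t s'"
inductive_cases runs_WhileE: "runs (While b c) s t s'"

lemma runs_deterministic:
  "runs c s t s' \<Longrightarrow> runs c s u s'' \<Longrightarrow> u = t \<and> s'' = s'"
proof (induction arbitrary: u s'' rule: runs.induct)
  case (Skip s) then show ?case by (rule runs_SkipE) simp
next
  case (NSet x i a s) then show ?case by (rule runs_NSetE) simp
next
  case (RSet x i a s) then show ?case by (rule runs_RSetE) simp
next
  case (Seq c1 s t1 s1 c2 t2 s2)
  from Seq.prems show ?case
  proof (rule runs_SeqE)
    fix u1 r1 u2
    assume u: "u = u1 + u2" and 1: "runs c1 s u1 r1" and 2: "runs c2 r1 u2 s''"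
    from Seq.IH(1)[OF 1] 2 have "runs c2 s1 u2 s''" by simp
    from Seq.IH(2)[OF this] Seq.IH(1)[OF 1] u show ?thesis by simp
  qed
next
  case (CondTrue s b c1 t s' c2)
  from CondTrue.prems show ?case
  proof (rule runs_CondE)
    fix u1 assume u: "u = Suc (bcost b + u1)" and 1: "runs c1 s u1 s''"
    from CondTrue.IH[OF 1] u show ?thesis by simp
  next
    assume "\<not> bval s b" with CondTrue.hyps(1) show ?thesis by contradiction
  qed
next
  case (CondFalse s b c2 t s' c1)
  from CondFalse.prems show ?case
  proof (rule runs_CondE)
    fix u1 assume u: "u = Suc (bcost b + u1)" and 1: "runs c2 s u1 s''"
    from CondFalse.IH[OF 1] u show ?thesis by simp
  next
    assume "bval s b" with CondFalse.hyps(1) show ?thesis by contradiction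
  qed
next
  case (WhileFalse s b c)
  from WhileFalse.prems show ?case
  proof (rule runs_WhileE)
    assume "u = Suc (bcost b)" "s'' = s" then show ?thesis by simp
  next
    assume "bval s b" with WhileFalse.hyps show ?thesis by contradiction
  qed
next
  case (WhileTrue s b c t1 s1 t2 s2)
  from WhileTrue.prems show ?case
  proof (rule runs_WhileE)
    assume "\<not> bval s b" with WhileTrue.hyps(1) show ?thesis by contradiction
  next
    fix u1 r1 u2
    assume u: "u = Suc (bcost b + u1 + u2)"
      and 1: "runs c s u1 r1" and 2: "runs (While b c) r1 u2 s''"
    from WhileTrue.IH(1)[OF 1] 2 have "runs (While b c) s1 u2 s''" by simp
    from WhileTrue.IH(2)[OF this] WhileTrue.IH(1)[OF 1] u show ?thesis by simp
  qed
qed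


section \<open>Input and output conventions\<close>

text \<open>The vertices are \<open>0, \<dots>, n - 1\<close>, and the graph is given by its adjacency matrix, stored row by
  row. All cells not holding input are \<open>0\<close>.\<close>

definition input_state :: "nat \<Rightarrow> nat set set \<Rightarrow> (nat \<Rightarrow> real) \<Rightarrow> real \<Rightarrow> state" where
  "input_state n E p \<alpha> =
     \<lparr>narr = (\<lambda>x k.
        if x = ''n'' \<and> k = 0 then n
        else if x = ''adj'' \<and> k < n * n \<and> {k div n, k mod n} \<in> E then 1
        else 0),
      rarr = (\<lambda>x k.
        if x = ''alpha'' \<and> k = 0 then \<alpha>
        else if x = ''p'' \<and> k < n then p k
        else 0)\<rparr>"

definition accepts :: "state \<Rightarrow> bool" where
  "accepts s \<longleftrightarrow> narr s ''out'' 0 = 1"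

text \<open>
  A reading of the running time \<open>(n / \<alpha>)\<close> to the power \<open>O(sqrt (n / \<alpha>) * log d)\<close>, where \<open>C\<close> is the
  constant of the \<open>O\<close>. The two maxima are relevant only for \<open>d \<le> 1\<close>, where \<open>log d\<close> is zero or
  undefined and the base can be \<open>1\<close>, so that the expression would not bound even the time for
  reading the input. If \<open>d \<ge> 2\<close>, then \<open>n \<ge> 3\<close>, and both maxima equal their second argument.
\<close>

definition time_bound :: "real \<Rightarrow> nat \<Rightarrow> nat \<Rightarrow> real \<Rightarrow> real" where
  "time_bound C n d \<alpha> =
     max 2 (real n / \<alpha>) powr (C * sqrt (real n / \<alpha>) * ln (max 2 (real d)))"

end

theory Submission
  imports Defs
begin

text \<open>
  Write \<open>q S x\<close> for the independence polynomial of \<open>G[S]\<close> at \<open>- x\<close>. The ratio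
  \<open>\<beta> S a = 1 - q S x / q (S - {a}) x\<close> satisfies
  \<open>\<beta> S a = x a * (\<Prod>w. 1 / (1 - \<beta> (S_w) w))\<close>, where \<open>w\<close> runs over the neighbours of \<open>a\<close> in \<open>S\<close> and
  \<open>S_w\<close> is \<open>S\<close> without \<open>a\<close> and the neighbours preceding \<open>w\<close>. Truncating this recursion at depth \<open>l\<close>
  gives lower bounds of \<open>\<beta>\<close>. The algorithm evaluates the truncated recursion at \<open>(1 + \<alpha>) p\<close> from every
  root \<open>(V, v)\<close> and accepts iff every value it meets is below \<open>1\<close>.

  In the Shearer region all ratios are below \<open>1\<close>, so a rejection is correct. Conversely let \<open>p\<close> be
  outside the region, and let \<open>t \<le> 1\<close> be the first zero of \<open>t \<mapsto> q V (t p)\<close>. With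
  \<open>\<delta> = \<alpha> / (8 n)\<close> and \<open>s = (1 - \<delta>) t\<close>, the mean value theorem yields a vertex \<open>v\<close> whose ratio at
  \<open>s p\<close> is at least \<open>1 - \<alpha> / 7\<close>. The point \<open>s p\<close> has slack \<open>\<delta>\<close>, hence the truncation error decays
  like \<open>(1 - sqrt \<delta> / 3) ^ l\<close>, and a depth \<open>l\<close> of order \<open>sqrt (n / \<alpha>) * ln (n / \<alpha>)\<close> brings
  the truncated value at \<open>(1 + \<alpha>) p\<close> up to \<open>1\<close>.

  The decay rate comes from the potential \<open>ln (\<beta> ((1 + \<delta>) x) / \<beta> x) - ln (1 + \<delta>)\<close>: a large potential
  is contracted by the convexity of \<open>exp\<close>, a small one by the subtracted term \<open>ln (1 + \<delta>)\<close>.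
\<close>

section \<open>The independence polynomial at negative arguments\<close>

definition nbrs :: "'a set set \<Rightarrow> 'a \<Rightarrow> 'a set" where
  "nbrs E a = {b. {a, b} \<in> E}"

text \<open>Generic in the ring, so that one deletion recursion serves both the complex polynomial
  of the region and the real \<open>q_poly\<close>.\<close>

definition ind_poly :: "'a set set \<Rightarrow> 'a set \<Rightarrow> ('a \<Rightarrow> 'b::comm_ring_1) \<Rightarrow> 'b" where
  "ind_poly E S x = (\<Sum>I\<in>indep_sets S E. \<Prod>v\<in>I. x v)"

definition q_poly :: "'a set set \<Rightarrow> 'a set \<Rightarrow> ('a \<Rightarrow> real) \<Rightarrow> real" where
  "q_poly E S x = ind_poly E S (\<lambda>v. - x v)"

definition q_pos :: "'a set set \<Rightarrow> 'a set \<Rightarrow> ('a \<Rightarrow> real) \<Rightarrow> bool" where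
  "q_pos E V x \<longleftrightarrow> (\<forall>S\<subseteq>V. q_poly E S x > 0)"

lemma indep_poly_eq: "indep_poly V E x = ind_poly E V x"
  by (simp add: indep_poly_def ind_poly_def)

lemma finite_indep_sets: "finite S \<Longrightarrow> finite (indep_sets S E)"
  by (rule finite_subset[of _ "Pow S"]) (auto simp: indep_sets_def)

lemma ind_poly_empty [simp]: "ind_poly E {} x = 1"
proof -
  have "indep_sets {} E = {{}}" by (auto simp: indep_sets_def)
  then show ?thesis by (simp add: ind_poly_def)
qed

lemma q_poly_empty [simp]: "q_poly E {} x = 1"
  by (simp add: q_poly_def)

lemma indep_sets_split:
  assumes "a \<in> S" "{a} \<notin> E"
  shows "indep_sets S E = indep_sets (S - {a}) E \<union> insert a ` indep_sets (S - {a} - nbrs E a) E"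
proof (intro equalityI subsetI)
  fix I assume I: "I \<in> indep_sets S E"
  show "I \<in> indep_sets (S - {a}) E \<union> insert a ` indep_sets (S - {a} - nbrs E a) E"
  proof (cases "a \<in> I")
    case True
    have "I - {a} \<in> indep_sets (S - {a} - nbrs E a) E"
      using I True unfolding indep_sets_def nbrs_def by auto
    moreover have "I = insert a (I - {a})" using True by auto
    ultimately show ?thesis by blast
  next
    case False
    then show ?thesis using I by (auto simp: indep_sets_def)
  qed
next
  fix I assume "I \<in> indep_sets (S - {a}) E \<union> insert a ` indep_sets (S - {a} - nbrs E a) E"
  then show "I \<in> indep_sets S E"
  proof
    assume "I \<in> indep_sets (S - {a}) E" then show ?thesis by (auto simp: indep_sets_def)
  next
    assume "I \<in> insert a ` indep_sets (S - {a} - nbrs E a) E"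
    then obtain J where J: "J \<in> indep_sets (S - {a} - nbrs E a) E" "I = insert a J" by auto
    have "\<And>v. v \<in> J \<Longrightarrow> {a, v} \<notin> E" "\<And>v. v \<in> J \<Longrightarrow> {v, a} \<notin> E"
      using J(1) by (auto simp: indep_sets_def nbrs_def insert_commute)
    then show ?thesis using J assms by (auto simp: indep_sets_def)
  qed
qed

lemma ind_poly_rec:
  assumes "finite S" "a \<in> S" "{a} \<notin> E"
  shows "ind_poly E S x = ind_poly E (S - {a}) x + x a * ind_poly E (S - {a} - nbrs E a) x"
proof -
  let ?A = "indep_sets (S - {a}) E" and ?B = "indep_sets (S - {a} - nbrs E a) E"
  have dis: "?A \<inter> insert a ` ?B = {}" by (auto simp: indep_sets_def)
  have inj: "inj_on (insert a) ?B" by (rule inj_onI) (auto simp: indep_sets_def)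
  have fin: "finite ?A" "finite ?B" using assms by (auto intro: finite_indep_sets)
  have *: "(\<Prod>v\<in>insert a J. x v) = x a * (\<Prod>v\<in>J. x v)" if "J \<in> ?B" for J
  proof -
    have "finite J" "a \<notin> J" using that assms(1) by (auto simp: indep_sets_def intro: finite_subset)
    then show ?thesis by simp
  qed
  have "ind_poly E S x = ind_poly E (S - {a}) x + (\<Sum>I\<in>insert a ` ?B. \<Prod>v\<in>I. x v)"
    unfolding ind_poly_def indep_sets_split[OF assms(2,3)]
    by (rule sum.union_disjoint) (use fin dis in auto)
  also have "(\<Sum>I\<in>insert a ` ?B. \<Prod>v\<in>I. x v) = (\<Sum>J\<in>?B. x a * (\<Prod>v\<in>J. x v))"
    by (subst sum.reindex[OF inj]) (auto intro!: sum.cong *)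
  also have "\<dots> = x a * ind_poly E (S - {a} - nbrs E a) x"
    by (simp add: ind_poly_def sum_distrib_left)
  finally show ?thesis .
qed

text \<open>Independence is tested for equal vertices too, so a singleton edge would exclude its
  vertex from every independent set; \<open>loopless\<close> rules this out for the deletion
  recursion.\<close>

locale shearer_graph =
  fixes E :: "'a set set" and V :: "'a set"
  assumes finite_V: "finite V" and loopless: "\<And>a. {a} \<notin> E"
begin

lemma finite_sub: "S \<subseteq> V \<Longrightarrow> finite S"
  using finite_V finite_subset by blast

lemma q_rec:
  assumes "S \<subseteq> V" "a \<in> S"
  shows "q_poly E S x = q_poly E (S - {a}) x - x a * q_poly E (S - {a} - nbrs E a) x"
  unfolding q_poly_def using ind_poly_rec[OF finite_sub[OF assms(1)] assms(2) loopless, where x = "\<lambda>v. - x v"] by simp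

lemma q_zero:
  assumes "S \<subseteq> V"
  shows "q_poly E S (\<lambda>v. 0) = 1"
  using finite_sub[OF assms] assms
proof (induction S rule: finite_induct)
  case (insert a S)
  then show ?case using q_rec[of "insert a S" a "\<lambda>v. 0"] by simp
qed simp

section \<open>Monotonicity of the polynomial and of its ratios\<close>

lemma q_posD: "q_pos E V x \<Longrightarrow> S \<subseteq> V \<Longrightarrow> q_poly E S x > 0"
  by (simp add: q_pos_def)

text \<open>Induction on \<open>card S\<close>. After removing a vertex \<open>a\<close> of
  \<open>S\<close> outside \<open>T\<close>, the induction hypothesis is used twice on
  \<open>?S\<close>: against \<open>?N\<close>, to control the recursion for \<open>S\<close>, and
  against \<open>T\<close>. The products avoid division, since \<open>ind_poly E S z\<close> is not
  yet known to be nonzero.\<close>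

lemma norm_ratio_mono:
  fixes z :: "'a \<Rightarrow> 'b::real_normed_field"
  assumes pos: "q_pos E V y" and z: "\<And>v. v \<in> V \<Longrightarrow> norm (z v) \<le> y v"
    and "S \<subseteq> V" "T \<subseteq> S"
  shows "norm (ind_poly E T z) * q_poly E S y \<le> norm (ind_poly E S z) * q_poly E T y"
  using assms(3,4)
proof (induction "card S" arbitrary: S T rule: less_induct)
  case less
  show ?case
  proof (cases "T = S")
    case False
    then obtain a where a: "a \<in> S" "a \<notin> T" using less.prems by blast
    let ?Z = "\<lambda>U. norm (ind_poly E U z)" and ?q = "\<lambda>U. q_poly E U y"
    let ?S = "S - {a}" and ?N = "S - {a} - nbrs E a"
    have aV: "a \<in> V" and sub: "?S \<subseteq> V" "?N \<subseteq> V" "T \<subseteq> V" "T \<subseteq> ?S" using a less.prems by auto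
    have qp: "?q S > 0" "?q ?S > 0" "?q T > 0" "?q ?N > 0"
      using less.prems sub q_posD[OF pos] by auto
    have lt: "card ?S < card S" using a finite_sub[OF less.prems(1)] by (metis card_Diff1_less)
    have 1: "?Z ?N * ?q ?S \<le> ?Z ?S * ?q ?N" by (rule less.hyps[OF lt sub(1)]) auto
    have 2: "?Z T * ?q ?S \<le> ?Z ?S * ?q T" by (rule less.hyps[OF lt sub(1) sub(4)])
    have "ind_poly E S z = ind_poly E ?S z + z a * ind_poly E ?N z"
      by (rule ind_poly_rec[OF finite_sub[OF less.prems(1)] a(1) loopless])
    then have "?Z ?S - norm (z a * ind_poly E ?N z) \<le> ?Z S"
      using norm_diff_ineq by metis
    moreover have "norm (z a * ind_poly E ?N z) \<le> y a * ?Z ?N"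
      by (simp add: norm_mult mult_right_mono z[OF aV])
    ultimately have 3: "?Z ?S - y a * ?Z ?N \<le> ?Z S" by linarith
    have y0: "0 \<le> y a" using z[OF aV] norm_ge_zero order_trans by blast
    \<comment> \<open>First the case \<open>T = ?S\<close>, where only one vertex is
      missing.\<close>
    have "?Z ?S * ?q S = ?Z ?S * ?q ?S - y a * (?Z ?S * ?q ?N)"
      unfolding q_rec[OF less.prems(1) a(1)] by (simp add: algebra_simps)
    also have "\<dots> \<le> ?Z ?S * ?q ?S - y a * (?Z ?N * ?q ?S)"
      using mult_left_mono[OF 1 y0] by linarith
    also have "\<dots> = (?Z ?S - y a * ?Z ?N) * ?q ?S" by (simp add: algebra_simps)
    also have "\<dots> \<le> ?Z S * ?q ?S" by (rule mult_right_mono[OF 3]) (use qp in simp)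
    finally have 4: "?Z ?S * ?q S \<le> ?Z S * ?q ?S" .
    \<comment> \<open>Chaining \<open>2\<close> and \<open>4\<close>; the extra factor
      \<open>?q ?S\<close> is positive and cancels at the end.\<close>
    have "(?Z T * ?q S) * ?q ?S = (?Z T * ?q ?S) * ?q S" by simp
    also have "\<dots> \<le> (?Z ?S * ?q T) * ?q S" by (rule mult_right_mono[OF 2]) (use qp in simp)
    also have "\<dots> = (?Z ?S * ?q S) * ?q T" by simp
    also have "\<dots> \<le> (?Z S * ?q ?S) * ?q T" by (rule mult_right_mono[OF 4]) (use qp in simp)
    finally have "(?Z T * ?q S) * ?q ?S \<le> (?Z S * ?q T) * ?q ?S" by (simp add: ac_simps)
    then show ?thesis using qp by simp
  qed simp
qed

text \<open>For \<open>T = {}\<close> the comparison reads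
  \<open>q_poly E S y \<le> norm (ind_poly E S z)\<close>.\<close>

lemma ind_poly_nonzero:
  fixes z :: "'a \<Rightarrow> 'b::real_normed_field"
  assumes "q_pos E V y" "\<And>v. v \<in> V \<Longrightarrow> norm (z v) \<le> y v" "S \<subseteq> V"
  shows "ind_poly E S z \<noteq> 0"
  using norm_ratio_mono[OF assms, of "{}"] q_posD[OF assms(1,3)] by auto

text \<open>The quotient of the polynomials of \<open>S\<close> and \<open>S - {a}\<close> is at
  least as large at \<open>x\<close> as at \<open>y\<close>, hence positive. The sign at
  \<open>x\<close> has to come from the induction, because \<open>norm_ratio_mono\<close> controls
  absolute values only.\<close>

lemma q_pos_antimono:
  assumes pos: "q_pos E V y" and x: "\<And>v. v \<in> V \<Longrightarrow> 0 \<le> x v" "\<And>v. v \<in> V \<Longrightarrow> x v \<le> y v"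
  shows "q_pos E V x"
proof -
  have "q_poly E S x > 0" if "S \<subseteq> V" for S
    using that
  proof (induction "card S" arbitrary: S rule: less_induct)
    case less
    show ?case
    proof (cases "S = {}")
      case False
      then obtain a where a: "a \<in> S" by blast
      let ?S = "S - {a}" and ?N = "S - {a} - nbrs E a"
      have aV: "a \<in> V" and sub: "?S \<subseteq> V" "?N \<subseteq> V" using a less.prems by auto
      have lt: "card ?S < card S" using a finite_sub[OF less.prems(1)] by (metis card_Diff1_less)
      have qx: "q_poly E ?S x > 0" by (rule less.hyps[OF lt sub(1)])
      have qy: "q_poly E ?S y > 0" "q_poly E S y > 0" "q_poly E ?N y > 0"
        using sub less.prems q_posD[OF pos] by auto
      have "\<bar>q_poly E ?N x\<bar> * q_poly E ?S y \<le> \<bar>q_poly E ?S x\<bar> * q_poly E ?N y"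
        using norm_ratio_mono[OF pos, of "\<lambda>v. - x v" ?S ?N] sub x by (auto simp: q_poly_def)
      then have 1: "q_poly E ?N x * q_poly E ?S y \<le> q_poly E ?S x * q_poly E ?N y"
        using qx qy by (smt (verit) mult_right_mono)
      have "q_poly E S x * q_poly E ?S y =
          q_poly E ?S x * q_poly E ?S y - x a * (q_poly E ?N x * q_poly E ?S y)"
        unfolding q_rec[OF less.prems a, of x] by (simp add: algebra_simps)
      moreover have "x a * (q_poly E ?N x * q_poly E ?S y) \<le> x a * (q_poly E ?S x * q_poly E ?N y)"
        by (rule mult_left_mono[OF 1 x(1)[OF aV]])
      moreover have "x a * (q_poly E ?S x * q_poly E ?N y) \<le> y a * (q_poly E ?S x * q_poly E ?N y)"
        using x(2)[OF aV] qx qy by (intro mult_right_mono) auto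
      moreover have "q_poly E ?S x * q_poly E S y =
          q_poly E ?S x * q_poly E ?S y - y a * (q_poly E ?S x * q_poly E ?N y)"
        unfolding q_rec[OF less.prems a, of y] by (simp add: algebra_simps)
      ultimately have "q_poly E S x * q_poly E ?S y \<ge> q_poly E ?S x * q_poly E S y"
        by linarith
      moreover have "q_poly E ?S x * q_poly E S y > 0" using qx qy by simp
      ultimately show ?thesis using qy by (metis less_le_trans zero_less_mult_pos2)
    qed simp
  qed
  then show ?thesis by (simp add: q_pos_def)
qed

lemma q_ratio_mono:
  assumes pos: "q_pos E V y" and x: "\<And>v. v \<in> V \<Longrightarrow> 0 \<le> x v" "\<And>v. v \<in> V \<Longrightarrow> x v \<le> y v"
    and "S \<subseteq> V" "T \<subseteq> S"
  shows "q_poly E T x * q_poly E S y \<le> q_poly E S x * q_poly E T y"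
proof -
  have p: "q_poly E T x > 0" "q_poly E S x > 0"
    using q_posD[OF q_pos_antimono[OF pos x]] assms by auto
  have "norm (ind_poly E T (\<lambda>v. - x v)) * q_poly E S y \<le> norm (ind_poly E S (\<lambda>v. - x v)) * q_poly E T y"
    by (rule norm_ratio_mono) (use assms in auto)
  then show ?thesis using p unfolding q_poly_def[symmetric] by simp
qed

text \<open>Comparison with the zero vector, where every \<open>q_poly\<close> is 1.\<close>

lemma q_antimono_set:
  assumes pos: "q_pos E V x" and x: "\<And>v. v \<in> V \<Longrightarrow> 0 \<le> x v" and "S \<subseteq> V" "T \<subseteq> S"
  shows "q_poly E S x \<le> q_poly E T x"
  using q_ratio_mono[of x "\<lambda>v. 0" S T] q_zero assms by simp

lemma q_antimono_point:
  assumes pos: "q_pos E V y" and x: "\<And>v. v \<in> V \<Longrightarrow> 0 \<le> x v" "\<And>v. v \<in> V \<Longrightarrow> x v \<le> y v"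
    and "S \<subseteq> V"
  shows "q_poly E S y \<le> q_poly E S x"
  using q_ratio_mono[OF pos x assms(4), of "{}"] by simp

section \<open>First zeros along rays and the Shearer region\<close>

lemma continuous_q [continuous_intros]:
  "continuous_on A (\<lambda>t. q_poly E S (\<lambda>v. t * p v))"
  unfolding q_poly_def ind_poly_def by (intro continuous_intros)

text \<open>\<open>t\<close> is the least element of the compact set \<open>B\<close> of parameters
  at which some \<open>S\<close> has a nonpositive polynomial. The polynomial of \<open>V\<close>
  then vanishes at \<open>t\<close>: below \<open>t\<close> it is positive and at most that of
  \<open>S\<close>, and both bounds pass to the limit from the left.\<close>

lemma first_zero:
  assumes p: "\<And>v. v \<in> V \<Longrightarrow> 0 \<le> p v" and npos: "\<not> q_pos E V p"
  obtains t where "0 < t" "t \<le> 1" "q_poly E V (\<lambda>v. t * p v) = 0"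
    "\<And>s. 0 \<le> s \<Longrightarrow> s < t \<Longrightarrow> q_pos E V (\<lambda>v. s * p v)"
proof -
  define B where "B = (\<Union>S\<in>Pow V. {0..1} \<inter> {t. q_poly E S (\<lambda>v. t * p v) \<le> 0})"
  have "closed ({0..1::real} \<inter> {t. q_poly E S (\<lambda>v. t * p v) \<le> 0})" for S
    by (intro closed_Int closed_Collect_le continuous_intros closed_atLeastAtMost)
  then have cl: "closed B"
    unfolding B_def using finite_V by (intro closed_UN) auto
  obtain S0 where "S0 \<subseteq> V" "q_poly E S0 p \<le> 0"
    using npos unfolding q_pos_def by (auto simp: not_less)
  then have ne: "B \<noteq> {}"
    unfolding B_def by (intro ex_in_conv[THEN iffD1] exI[of _ 1]) auto
  have "compact B"
  proof -
    have "compact ({0..1} \<inter> B)" by (rule compact_Int_closed[OF compact_Icc cl])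
    moreover have "{0..1} \<inter> B = B" by (auto simp: B_def)
    ultimately show ?thesis by simp
  qed
  from compact_attains_inf[OF this ne] obtain t where tB: "t \<in> B" and tmin: "\<And>s. s \<in> B \<Longrightarrow> t \<le> s"
    by blast
  then obtain S where S: "S \<subseteq> V" "q_poly E S (\<lambda>v. t * p v) \<le> 0" and t01: "0 \<le> t" "t \<le> 1"
    unfolding B_def by auto
  have t0: "t \<noteq> 0" using S q_zero[OF S(1)] by auto
  have pos: "q_pos E V (\<lambda>v. s * p v)" if s: "0 \<le> s" "s < t" for s
  proof (rule ccontr)
    assume "\<not> ?thesis"
    then have "s \<in> B" using s t01 by (auto simp: B_def q_pos_def not_less)
    then have "t \<le> s" by (rule tmin)
    then show False using s by simp
  qed
  have lim: "((\<lambda>t. q_poly E U (\<lambda>v. t * p v)) \<longlongrightarrow> q_poly E U (\<lambda>v. t * p v)) (at_left t)" for U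
    using continuous_q[of UNIV U p] unfolding continuous_on_def
    by (auto intro: tendsto_within_subset)
  have ev: "\<forall>\<^sub>F s in at_left t. 0 < s \<and> s < t"
    using eventually_at_left_real[of 0 t] t0 t01 by (auto elim!: eventually_mono)
  have nt: "at_left t \<noteq> bot" by simp
  have "0 \<le> q_poly E V (\<lambda>v. t * p v)"
    by (rule tendsto_lowerbound[OF lim _ nt], rule eventually_mono[OF ev])
       (use pos in \<open>auto simp: q_pos_def intro: less_imp_le\<close>)
  moreover have "q_poly E V (\<lambda>v. t * p v) \<le> q_poly E S (\<lambda>v. t * p v)"
  proof (rule tendsto_le[OF nt lim lim], rule eventually_mono[OF ev])
    fix s assume "0 < s \<and> s < t"
    then show "q_poly E V (\<lambda>v. s * p v) \<le> q_poly E S (\<lambda>v. s * p v)"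
      using pos[of s] p S(1) by (intro q_antimono_set) auto
  qed
  ultimately have "q_poly E V (\<lambda>v. t * p v) = 0" using S(2) by linarith
  with that[OF _ t01(2) this pos] t0 t01 show ?thesis by auto
qed

text \<open>If positivity fails, the first zero \<open>t \<le> 1\<close> yields the zero
  \<open>- t * p\<close> inside the polydisc; the other direction is
  \<open>ind_poly_nonzero\<close>.\<close>

lemma shearer_region_iff:
  assumes p: "\<And>v. v \<in> V \<Longrightarrow> 0 \<le> p v" "\<And>v. v \<in> V \<Longrightarrow> p v \<le> 1"
  shows "p \<in> shearer_region V E \<longleftrightarrow> q_pos E V p"
proof
  assume "q_pos E V p"
  then show "p \<in> shearer_region V E"
    using ind_poly_nonzero[of p _ V] p unfolding shearer_region_def indep_poly_eq by auto
next
  assume r: "p \<in> shearer_region V E"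
  show "q_pos E V p"
  proof (rule ccontr)
    assume "\<not> ?thesis"
    then obtain t where t: "0 < t" "t \<le> 1" "q_poly E V (\<lambda>v. t * p v) = 0"
      using first_zero[of p] p by metis
    have "complex_of_real (q_poly E V (\<lambda>v. t * p v)) = ind_poly E V (\<lambda>v. - complex_of_real (t * p v))"
      by (simp add: q_poly_def ind_poly_def)
    then have "indep_poly V E (\<lambda>v. - complex_of_real (t * p v)) = 0"
      using t by (simp add: indep_poly_eq)
    moreover have "cmod (- complex_of_real (t * p v)) \<le> p v" if "v \<in> V" for v
      using t p(1)[OF that] by (simp add: norm_mult mult_left_le_one_le)
    moreover have "indep_poly V E z \<noteq> 0" if "\<And>v. v \<in> V \<Longrightarrow> cmod (z v) \<le> p v" for z
      using r that by (simp add: shearer_region_def)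
    ultimately show False by meson
  qed
qed

section \<open>The derivative along a ray and a vertex of large ratio\<close>

lemma q_has_derivative:
  assumes "S \<subseteq> V"
  shows "((\<lambda>t. q_poly E S (\<lambda>v. t * p v)) has_real_derivative
     - (\<Sum>v\<in>S. p v * q_poly E (S - {v} - nbrs E v) (\<lambda>v. t * p v))) (at t)"
  using assms
proof (induction "card S" arbitrary: S rule: less_induct)
  case less
  show ?case
  proof (cases "S = {}")
    case False
    then obtain a where a: "a \<in> S" by blast
    let ?S = "S - {a}" and ?N = "S - {a} - nbrs E a"
    let ?q = "\<lambda>U. q_poly E U (\<lambda>v. t * p v)"
    have fin: "finite S" using finite_sub[OF less.prems] .
    have lt: "card ?S < card S" "card ?N < card S"
      using a by (auto intro!: psubset_card_mono[OF fin] simp del: card_Diff_insert card_Diff_singleton)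
    have sub: "?S \<subseteq> V" "?N \<subseteq> V" using less.prems by auto
    \<comment> \<open>The summand of \<open>v\<close> can be expanded at \<open>a\<close>, except
      when \<open>a\<close> is a neighbour of \<open>v\<close> and has already been removed.\<close>
    have step: "?q (S - {v} - nbrs E v) = ?q (?S - {v} - nbrs E v)
        - (if v \<in> nbrs E a then 0 else t * p a * ?q (?N - {v} - nbrs E v))" if v: "v \<in> ?S" for v
    proof (cases "v \<in> nbrs E a")
      case True
      then have "a \<in> nbrs E v" by (simp add: nbrs_def insert_commute)
      then have "S - {v} - nbrs E v = ?S - {v} - nbrs E v" by auto
      then show ?thesis using True by simp
    next
      case False
      then have "a \<in> S - {v} - nbrs E v" using a v by (auto simp: nbrs_def insert_commute)
      moreover have "S - {v} - nbrs E v - {a} = ?S - {v} - nbrs E v"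
        "S - {v} - nbrs E v - {a} - nbrs E a = ?N - {v} - nbrs E v" by auto
      ultimately show ?thesis
        using q_rec[of "S - {v} - nbrs E v" a "\<lambda>v. t * p v"] less.prems False by auto
    qed
    have "(\<Sum>v\<in>S. p v * ?q (S - {v} - nbrs E v)) =
        p a * ?q ?N + (\<Sum>v\<in>?S. p v * ?q (S - {v} - nbrs E v))"
      using a fin by (simp add: sum.remove)
    also have "(\<Sum>v\<in>?S. p v * ?q (S - {v} - nbrs E v)) =
        (\<Sum>v\<in>?S. p v * ?q (?S - {v} - nbrs E v)
          - t * p a * (if v \<in> nbrs E a then 0 else p v * ?q (?N - {v} - nbrs E v)))"
      by (rule sum.cong) (auto simp: step algebra_simps)
    also have "\<dots> = (\<Sum>v\<in>?S. p v * ?q (?S - {v} - nbrs E v))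
        - t * p a * (\<Sum>v\<in>?S. if v \<in> nbrs E a then 0 else p v * ?q (?N - {v} - nbrs E v))"
      by (simp add: sum_subtractf sum_distrib_left)
    also have "(\<Sum>v\<in>?S. if v \<in> nbrs E a then 0 else p v * ?q (?N - {v} - nbrs E v)) =
        (\<Sum>v\<in>?N. p v * ?q (?N - {v} - nbrs E v))"
      by (rule sum.mono_neutral_cong_right) (use fin in auto)
    \<comment> \<open>The right-hand side is what the product rule gives for the recursion at
      \<open>a\<close>.\<close>
    finally have D: "- (\<Sum>v\<in>S. p v * ?q (S - {v} - nbrs E v)) =
        - (\<Sum>v\<in>?S. p v * ?q (?S - {v} - nbrs E v)) -
        (p a * ?q ?N + t * p a * - (\<Sum>v\<in>?N. p v * ?q (?N - {v} - nbrs E v)))"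
      by simp
    have f: "(\<lambda>t. q_poly E S (\<lambda>v. t * p v)) =
        (\<lambda>t. q_poly E ?S (\<lambda>v. t * p v) - t * p a * q_poly E ?N (\<lambda>v. t * p v))"
      by (rule ext) (rule q_rec[OF less.prems a])
    show ?thesis
      unfolding f D
      using DERIV_diff[OF less.hyps[OF lt(1) sub(1)]
          DERIV_mult[OF DERIV_cmult_right[OF DERIV_ident, where c = "p a"] less.hyps[OF lt(2) sub(2)]]]
      by (simp add: algebra_simps)
  qed simp
qed

end

text \<open>The \<open>\<beta>\<close> of the introduction, rewritten by \<open>q_rec\<close> so
  that its sign is visible; see \<open>one_minus_ratio\<close>.\<close>

definition ratio :: "'a set set \<Rightarrow> ('a \<Rightarrow> real) \<Rightarrow> 'a set \<Rightarrow> 'a \<Rightarrow> real" where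
  "ratio E x S a = x a * q_poly E (S - {a} - nbrs E a) x / q_poly E (S - {a}) x"

context shearer_graph
begin

text \<open>The mean value theorem expresses the polynomial of \<open>V\<close> at \<open>s\<close>
  by its derivative at some later \<open>\<xi>\<close>, which is at most the derivative at
  \<open>s\<close> in absolute value because all \<open>q_poly\<close> decrease along the ray. Some
  vertex contributes at least the average of the sum, and at this vertex the polynomial of
  \<open>V\<close> is \<open>1 - \<beta>\<close> times that of \<open>V - {v}\<close>.\<close>

lemma exists_large_ratio:
  fixes s t :: real
  assumes p: "\<And>v. v \<in> V \<Longrightarrow> 0 \<le> p v" and s: "0 \<le> s" "s < t"
    and z: "q_poly E V (\<lambda>v. t * p v) = 0"
    and pos: "\<And>s. 0 \<le> s \<Longrightarrow> s < t \<Longrightarrow> q_pos E V (\<lambda>v. s * p v)"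
  shows "\<exists>v\<in>V. s * (1 - ratio E (\<lambda>v. s * p v) V v) \<le> card V * (t - s) * ratio E (\<lambda>v. s * p v) V v"
proof -
  let ?q = "\<lambda>s U. q_poly E U (\<lambda>v. s * p v)"
  obtain \<xi> where \<xi>: "s < \<xi>" "\<xi> < t"
    "?q t V - ?q s V = (t - s) * - (\<Sum>v\<in>V. p v * ?q \<xi> (V - {v} - nbrs E v))"
    using MVT2[of s t "\<lambda>s. ?q s V" "\<lambda>s. - (\<Sum>v\<in>V. p v * ?q s (V - {v} - nbrs E v))"]
      q_has_derivative[OF subset_refl] s(2) by blast
  have le: "?q \<xi> U \<le> ?q s U" if "U \<subseteq> V" for U
    by (rule q_antimono_point[OF pos _ _ that]) (use \<xi> s p in \<open>auto intro: mult_right_mono\<close>)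
  have "?q s V = (t - s) * (\<Sum>v\<in>V. p v * ?q \<xi> (V - {v} - nbrs E v))"
    using \<xi>(3) z by simp
  also have "\<dots> \<le> (t - s) * (\<Sum>v\<in>V. p v * ?q s (V - {v} - nbrs E v))"
    using s by (intro mult_left_mono sum_mono le) (auto simp: p)
  also have "\<dots> = (\<Sum>v\<in>V. (t - s) * (p v * ?q s (V - {v} - nbrs E v)))"
    by (simp add: sum_distrib_left)
  finally have sum: "?q s V \<le> (\<Sum>v\<in>V. (t - s) * (p v * ?q s (V - {v} - nbrs E v)))" .
  have q0: "?q s U > 0" if "U \<subseteq> V" for U using pos[OF s] that by (simp add: q_pos_def)
  have V0: "V \<noteq> {}" using z by auto
  have "\<exists>v\<in>V. ?q s V \<le> card V * ((t - s) * (p v * ?q s (V - {v} - nbrs E v)))"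
  proof (rule ccontr)
    assume "\<not> ?thesis"
    then have "(\<Sum>v\<in>V. card V * ((t - s) * (p v * ?q s (V - {v} - nbrs E v)))) < (\<Sum>v\<in>V. ?q s V)"
      using V0 finite_V by (intro sum_strict_mono) auto
    then have "card V * (\<Sum>v\<in>V. (t - s) * (p v * ?q s (V - {v} - nbrs E v))) < card V * ?q s V"
      by (simp add: sum_distrib_left)
    then show False using mult_left_mono[OF sum, of "card V"] by simp
  qed
  then obtain v where v: "v \<in> V" "?q s V \<le> card V * ((t - s) * (p v * ?q s (V - {v} - nbrs E v)))"
    by blast
  let ?b = "ratio E (\<lambda>v. s * p v) V v"
  have qv: "?q s (V - {v}) > 0" by (rule q0) auto
  have b: "?b * ?q s (V - {v}) = s * p v * ?q s (V - {v} - nbrs E v)"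
    using qv by (simp add: ratio_def)
  have "?q s V = (1 - ?b) * ?q s (V - {v})"
    using q_rec[OF subset_refl v(1), of "\<lambda>v. s * p v"] b by (simp add: algebra_simps)
  then have "s * (1 - ?b) * ?q s (V - {v}) \<le> s * (card V * ((t - s) * (p v * ?q s (V - {v} - nbrs E v))))"
    using mult_left_mono[OF v(2) s(1)] by (simp add: mult.assoc)
  also have "\<dots> = card V * (t - s) * ?b * ?q s (V - {v})"
    using b by (simp add: mult_ac)
  finally show ?thesis using qv v(1) by (auto simp: mult.assoc)
qed

end

section \<open>Decay of the truncation error\<close>

definition child_set :: "'a::linorder set set \<Rightarrow> 'a set \<Rightarrow> 'a \<Rightarrow> 'a \<Rightarrow> 'a set" where
  "child_set E S a w = S - {a} - (nbrs E a \<inter> {..<w})"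

primrec tree_val :: "'a::linorder set set \<Rightarrow> ('a \<Rightarrow> real) \<Rightarrow> nat \<Rightarrow> 'a set \<Rightarrow> 'a \<Rightarrow> real" where
  "tree_val E x 0 S a = x a"
| "tree_val E x (Suc f) S a = x a * (\<Prod>w\<in>S \<inter> nbrs E a. 1 / (1 - tree_val E x f (child_set E S a w) w))"

text \<open>A value is meaningful only if all values below it are less than 1: otherwise some factor
  is negative, or 0 by the convention for division by 0. Hence the condition ranges over the whole
  tree.\<close>

primrec tree_ok :: "'a::linorder set set \<Rightarrow> ('a \<Rightarrow> real) \<Rightarrow> nat \<Rightarrow> 'a set \<Rightarrow> 'a \<Rightarrow> bool" where
  "tree_ok E x 0 S a \<longleftrightarrow> tree_val E x 0 S a < 1"
| "tree_ok E x (Suc f) S a \<longleftrightarrow> tree_val E x (Suc f) S a < 1 \<and>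
     (\<forall>w\<in>S \<inter> nbrs E a. tree_ok E x f (child_set E S a w) w)"

lemma tree_ok_less_1: "tree_ok E x f S a \<Longrightarrow> tree_val E x f S a < 1"
  by (cases f) auto

text \<open>All factors grow with the values of the children, and the vertex itself supplies
  \<open>c\<close>. The assumption concerns the tree at \<open>y\<close> and not the Shearer region,
  because the point \<open>(1 + \<alpha>) p\<close> to which this is applied may lie outside the
  region.\<close>

lemma tree_val_mono:
  assumes x: "\<And>v. v \<in> V \<Longrightarrow> 0 \<le> x v" and c: "1 \<le> c" "\<And>v. v \<in> V \<Longrightarrow> c * x v \<le> y v"
    and "S \<subseteq> V" "a \<in> V" "tree_ok E y f S a"
  shows "0 \<le> tree_val E x f S a \<and> c * tree_val E x f S a \<le> tree_val E y f S a"
  using assms(4-)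
proof (induction f arbitrary: S a)
  case 0
  then show ?case using x c by simp
next
  case (Suc f)
  let ?g = "\<lambda>z w. 1 / (1 - tree_val E z f (child_set E S a w) w)"
  let ?N = "S \<inter> nbrs E a"
  have *: "0 \<le> ?g x w \<and> ?g x w \<le> ?g y w" if w: "w \<in> ?N" for w
  proof -
    let ?x = "tree_val E x f (child_set E S a w) w" and ?y = "tree_val E y f (child_set E S a w) w"
    have ok: "tree_ok E y f (child_set E S a w) w" using Suc.prems w by simp
    have "child_set E S a w \<subseteq> V" "w \<in> V" using Suc.prems w by (auto simp: child_set_def)
    then have "0 \<le> ?x" "c * ?x \<le> ?y" "?y < 1" using Suc.IH[OF _ _ ok] tree_ok_less_1[OF ok] by auto
    moreover have "1 * ?x \<le> c * ?x" using c \<open>0 \<le> ?x\<close> by (intro mult_right_mono) auto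
    ultimately have "?x \<le> ?y" "?y < 1" by auto
    then show ?thesis by (auto intro!: divide_left_mono)
  qed
  have p: "0 \<le> prod (?g x) ?N" "prod (?g x) ?N \<le> prod (?g y) ?N"
    using * by (auto intro!: prod_nonneg prod_mono)
  have xa: "0 \<le> x a" "c * x a \<le> y a" using x c Suc.prems by auto
  moreover have "0 \<le> c * x a" using xa c by simp
  ultimately have "c * x a * prod (?g x) ?N \<le> y a * prod (?g y) ?N"
    using p by (intro mult_mono) auto
  then show ?case using p xa by (simp add: mult.assoc)
qed

section \<open>Contraction of the potential\<close>

lemma log_quotient_ge:
  assumes "0 < b" "b < 1" "b' < (1::real)"
  shows "b / (1 - b) * (b' / b - 1) \<le> ln ((1 - b) / (1 - b'))"
proof -
  have "ln ((1 - b') / (1 - b)) \<le> (1 - b') / (1 - b) - 1"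
    by (rule ln_le_minus_one) (use assms in auto)
  moreover have "ln ((1 - b') / (1 - b)) = - ln ((1 - b) / (1 - b'))"
    using assms by (simp add: ln_div)
  moreover have "b / (1 - b) * (b' / b - 1) = 1 - (1 - b') / (1 - b)"
    using assms by (simp add: field_simps)
  ultimately show ?thesis by linarith
qed

text \<open>\<open>b\<close> and \<open>b'\<close> are the ratios of a child at \<open>x\<close> and
  at \<open>(1 + \<delta>) x\<close>. The weight \<open>b / (1 - b)\<close> is the derivative of
  \<open>ln (1 / (1 - b))\<close> with respect to \<open>ln b\<close>; the logarithm on the right is
  the child's share in the potential of its parent, see \<open>ln_ratio_scaled\<close>. Each level
  thus gains the factor \<open>1 - K / 3\<close>.\<close>

lemma potential_contraction:
  fixes b b' \<delta> K :: real
  assumes b: "0 < b" "b < 1" "b' < 1" "(1 + \<delta>) * b \<le> b'"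
    and K: "0 < K" "K\<^sup>2 \<le> \<delta>" "\<delta> \<le> 1"
  shows "b / (1 - b) * (ln (b' / b) - ln (1 + \<delta>)) \<le> (1 - K / 3) * ln ((1 - b) / (1 - b'))"
proof -
  define \<Phi> where "\<Phi> = ln (b' / b)"
  have d0: "0 < \<delta>" using K by (smt (verit) zero_less_power)
  have K1: "K \<le> 1" using K by (smt (verit) one_less_power pos2)
  have b'0: "0 < b'" using b d0 by (smt (verit) mult_pos_pos)
  have r: "1 + \<delta> \<le> b' / b" using b by (simp add: field_simps)
  have e: "exp \<Phi> = b' / b" using b b'0 by (simp add: \<Phi>_def)
  have \<Phi>0: "0 \<le> \<Phi>" using r d0 by (simp add: \<Phi>_def)
  have w0: "0 < b / (1 - b)" using b by simp
  have "ln (1 / (1 + \<delta>)) \<le> 1 / (1 + \<delta>) - 1" by (rule ln_le_minus_one) (use d0 in simp)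
  then have "\<delta> / (1 + \<delta>) \<le> ln (1 + \<delta>)" using d0 by (simp add: ln_div field_simps)
  moreover have "\<delta> / 2 \<le> \<delta> / (1 + \<delta>)" using d0 K by (intro divide_left_mono) auto
  ultimately have l: "K\<^sup>2 / 2 \<le> ln (1 + \<delta>)" using K by linarith
  \<comment> \<open>A completed square; \<open>K \<le> 1\<close> makes
    \<open>(1 - K / 3) / 2\<close> at least \<open>1 / 3\<close>.\<close>
  have "0 \<le> (K - \<Phi> / 3)\<^sup>2 / 2 + 5 / 18 * \<Phi>\<^sup>2" by simp
  also have "\<dots> = K\<^sup>2 / 2 - K * \<Phi> / 3 + 1 / 3 * \<Phi>\<^sup>2" by (simp add: power2_eq_square field_simps)
  also have "\<dots> \<le> K\<^sup>2 / 2 - K * \<Phi> / 3 + (1 - K / 3) / 2 * \<Phi>\<^sup>2"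
    using K1 by (intro add_left_mono mult_right_mono) auto
  finally have "\<Phi> - ln (1 + \<delta>) \<le> (1 - K / 3) * (\<Phi> + \<Phi>\<^sup>2 / 2)"
    using l by (simp add: algebra_simps)
  \<comment> \<open>Convexity enters here, as
    \<open>exp \<Phi> - 1 \<ge> \<Phi> + \<Phi>\<^sup>2 / 2\<close>.\<close>
  also have "\<dots> \<le> (1 - K / 3) * (b' / b - 1)"
    using exp_lower_Taylor_quadratic[OF \<Phi>0] K1 unfolding e by (intro mult_left_mono) auto
  finally have "b / (1 - b) * (\<Phi> - ln (1 + \<delta>)) \<le> b / (1 - b) * ((1 - K / 3) * (b' / b - 1))"
    using w0 by (intro mult_left_mono) auto
  also have "\<dots> = (1 - K / 3) * (b / (1 - b) * (b' / b - 1))" by simp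
  also have "\<dots> \<le> (1 - K / 3) * ln ((1 - b) / (1 - b'))"
    using log_quotient_ge[OF b(1-3)] K1 by (intro mult_left_mono) auto
  finally show ?thesis by (simp add: \<Phi>_def)
qed

locale ordered_graph = shearer_graph E V for E :: "'a::linorder set set" and V
begin

section \<open>The recursion for the exact ratios\<close>

lemma child_set:
  assumes "S \<subseteq> V" "w \<in> S \<inter> nbrs E a"
  shows "child_set E S a w \<subseteq> V" "w \<in> child_set E S a w"
  using assms loopless[of a] by (auto simp: child_set_def nbrs_def)

lemma one_minus_ratio:
  assumes "q_pos E V x" "S \<subseteq> V" "a \<in> S"
  shows "1 - ratio E x S a = q_poly E S x / q_poly E (S - {a}) x"
proof -
  have "q_poly E (S - {a}) x > 0" using assms by (intro q_posD[OF assms(1)]) auto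
  then show ?thesis using q_rec[OF assms(2,3), of x] by (simp add: ratio_def field_simps)
qed

lemma ratio_less_1:
  assumes "q_pos E V x" "S \<subseteq> V" "a \<in> S"
  shows "ratio E x S a < 1"
proof -
  have "q_poly E (S - {a}) x > 0" "q_poly E S x > 0"
    using assms by (auto intro: q_posD[OF assms(1)])
  then have "1 - ratio E x S a > 0" unfolding one_minus_ratio[OF assms] by simp
  then show ?thesis by simp
qed

lemma ratio_pos:
  assumes "q_pos E V x" "S \<subseteq> V" "a \<in> S" "0 < x a"
  shows "0 < ratio E x S a"
proof -
  have "q_poly E (S - {a}) x > 0" "q_poly E (S - {a} - nbrs E a) x > 0"
    using assms by (auto intro!: q_posD[OF assms(1)])
  then show ?thesis using assms(4) by (simp add: ratio_def)
qed

text \<open>The quotient of polynomials in \<open>ratio\<close> is monotone by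
  \<open>q_ratio_mono\<close>, and the factor \<open>x a\<close> supplies \<open>c\<close>. For
  \<open>c = 1 + \<delta>\<close> this says that the potential is nonnegative.\<close>

lemma ratio_scale:
  assumes pos: "q_pos E V y" and x: "\<And>v. v \<in> V \<Longrightarrow> 0 \<le> x v" "\<And>v. v \<in> V \<Longrightarrow> x v \<le> y v"
    and S: "S \<subseteq> V" "a \<in> S" and c: "0 \<le> c" "c * x a \<le> y a"
  shows "c * ratio E x S a \<le> ratio E y S a"
proof -
  let ?S = "S - {a}" and ?N = "S - {a} - nbrs E a"
  have px: "q_pos E V x" by (rule q_pos_antimono[OF pos x])
  have sub: "?S \<subseteq> V" "?N \<subseteq> V" using S by auto
  note q = q_posD[OF px sub(1)] q_posD[OF px sub(2)]
    q_posD[OF pos sub(1)] q_posD[OF pos sub(2)]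
  have "q_poly E ?N x * q_poly E ?S y \<le> q_poly E ?S x * q_poly E ?N y"
    by (rule q_ratio_mono[OF pos x]) (use S in auto)
  then have "q_poly E ?N x / q_poly E ?S x \<le> q_poly E ?N y / q_poly E ?S y"
    using q by (simp add: field_simps)
  moreover have "0 \<le> c * x a" using c x(1)[of a] S by auto
  then have "0 \<le> y a" using c by linarith
  ultimately have "c * x a * (q_poly E ?N x / q_poly E ?S x) \<le> y a * (q_poly E ?N y / q_poly E ?S y)"
    using c q by (intro mult_mono) auto
  then show ?thesis by (simp add: ratio_def)
qed

text \<open>By \<open>one_minus_ratio\<close> each factor is a quotient of the polynomials of two
  sets differing in one vertex. Since the neighbours are removed in increasing order, the product
  telescopes.\<close>

lemma ratio_rec:
  assumes pos: "q_pos E V x" and S: "S \<subseteq> V" "a \<in> S"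
  shows "ratio E x S a = x a * (\<Prod>w\<in>S \<inter> nbrs E a. 1 / (1 - ratio E x (child_set E S a w) w))"
proof -
  let ?S = "S - {a}"
  let ?f = "\<lambda>A w. q_poly E (?S - (A \<inter> {..<w}) - {w}) x / q_poly E (?S - (A \<inter> {..<w})) x"
  have q0: "q_poly E U x \<noteq> 0" if "U \<subseteq> V" for U using q_posD[OF pos that] by simp
  have tele: "(\<Prod>w\<in>A. ?f A w) = q_poly E (?S - A) x / q_poly E ?S x" if "A \<subseteq> ?S" for A
    using finite_subset[OF that finite_Diff[OF finite_sub[OF S(1)]]] that
  proof (induction A rule: finite_linorder_max_induct)
    case empty
    have "?S \<subseteq> V" using S by auto
    then show ?case using q0 by simp
  next
    case (insert b A)
    have "b \<notin> A" using insert.hyps by auto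
    \<comment> \<open>\<open>?f A w\<close> depends only on the members of \<open>A\<close> below
      \<open>w\<close>, so a new maximum \<open>b\<close> changes no earlier factor.\<close>
    have "?f (insert b A) w = ?f A w" if "w \<in> A" for w
    proof -
      have "insert b A \<inter> {..<w} = A \<inter> {..<w}" using insert.hyps that by force
      then show ?thesis by simp
    qed
    then have "(\<Prod>w\<in>insert b A. ?f (insert b A) w) = ?f (insert b A) b * (\<Prod>w\<in>A. ?f A w)"
      using insert.hyps \<open>b \<notin> A\<close> by simp
    also have "insert b A \<inter> {..<b} = A" using insert.hyps by auto
    also have "(\<Prod>w\<in>A. ?f A w) = q_poly E (?S - A) x / q_poly E ?S x"
      using insert by auto
    also have "?S - A - {b} = ?S - insert b A" by auto
    finally show ?case using q0[of "?S - A"] S by auto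
  qed
  have "(\<Prod>w\<in>S \<inter> nbrs E a. 1 / (1 - ratio E x (child_set E S a w) w)) =
      (\<Prod>w\<in>S \<inter> nbrs E a. ?f (S \<inter> nbrs E a) w)"
  proof (rule prod.cong[OF refl])
    fix w assume w: "w \<in> S \<inter> nbrs E a"
    have "child_set E S a w = ?S - (S \<inter> nbrs E a \<inter> {..<w})" by (auto simp: child_set_def)
    then show "1 / (1 - ratio E x (child_set E S a w) w) = ?f (S \<inter> nbrs E a) w"
      unfolding one_minus_ratio[OF pos child_set[OF S(1) w]] by simp
  qed
  also have "\<dots> = q_poly E (?S - (S \<inter> nbrs E a)) x / q_poly E ?S x"
    by (rule tele) (use loopless[of a] in \<open>auto simp: nbrs_def\<close>)
  also have "?S - (S \<inter> nbrs E a) = ?S - nbrs E a" by auto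
  finally show ?thesis by (simp add: ratio_def)
qed

text \<open>Truncation replaces the ratios of the children by smaller positive numbers, so every
  factor decreases but stays positive. As exact ratios are below 1, no tree fails at a point of the
  Shearer region.\<close>

lemma tree_val_le_ratio:
  assumes pos: "q_pos E V x" and x: "\<And>v. v \<in> V \<Longrightarrow> 0 < x v" and S: "S \<subseteq> V" "a \<in> S"
  shows "0 < tree_val E x f S a \<and> tree_val E x f S a \<le> ratio E x S a \<and> tree_ok E x f S a"
  using S
proof (induction f arbitrary: S a)
  case 0
  have "x a * 1 \<le> x a * (\<Prod>w\<in>S \<inter> nbrs E a. 1 / (1 - ratio E x (child_set E S a w) w))"
  proof (rule mult_left_mono)
    have "1 \<le> 1 / (1 - ratio E x (child_set E S a w) w)" if "w \<in> S \<inter> nbrs E a" for w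
      using ratio_less_1[OF pos child_set[OF 0(1) that]] ratio_pos[OF pos child_set[OF 0(1) that]]
        x that 0 by (auto simp: field_simps)
    then show "1 \<le> (\<Prod>w\<in>S \<inter> nbrs E a. 1 / (1 - ratio E x (child_set E S a w) w))"
      by (rule prod_ge_1)
    show "0 \<le> x a" using x[of a] 0 by auto
  qed
  then show ?case using ratio_rec[OF pos 0] ratio_less_1[OF pos 0] x[of a] 0 by auto
next
  case (Suc f)
  have xa: "0 < x a" using x Suc.prems by auto
  have *: "0 < 1 / (1 - tree_val E x f (child_set E S a w) w) \<and>
      1 / (1 - tree_val E x f (child_set E S a w) w) \<le> 1 / (1 - ratio E x (child_set E S a w) w)"
    if "w \<in> S \<inter> nbrs E a" for w
    using ratio_less_1[OF pos child_set[OF Suc.prems(1) that]] Suc.IH[OF child_set[OF Suc.prems(1) that]]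
    by (auto intro!: divide_left_mono)
  have "0 < (\<Prod>w\<in>S \<inter> nbrs E a. 1 / (1 - tree_val E x f (child_set E S a w) w))"
    using * by (intro prod_pos) auto
  moreover have "(\<Prod>w\<in>S \<inter> nbrs E a. 1 / (1 - tree_val E x f (child_set E S a w) w))
      \<le> (\<Prod>w\<in>S \<inter> nbrs E a. 1 / (1 - ratio E x (child_set E S a w) w))"
    using * by (intro prod_mono) (auto intro: less_imp_le)
  ultimately have "0 < tree_val E x (Suc f) S a" "tree_val E x (Suc f) S a \<le> ratio E x S a"
    unfolding ratio_rec[OF pos Suc.prems] using xa by auto
  then show ?case
    using ratio_less_1[OF pos Suc.prems] Suc.IH[OF child_set[OF Suc.prems(1)]] by auto
qed

text \<open>The factor \<open>1 + \<delta>\<close> from the vertex itself cancels against the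
  subtracted term, so the potential of a vertex is exactly a sum over its children.\<close>

lemma ln_ratio_scaled:
  fixes \<delta> :: real
  assumes pos: "q_pos E V (\<lambda>v. (1 + \<delta>) * x v)" and x: "\<And>v. v \<in> V \<Longrightarrow> 0 < x v" and d: "0 \<le> \<delta>"
    and S: "S \<subseteq> V" "a \<in> S"
  shows "ln (ratio E (\<lambda>v. (1 + \<delta>) * x v) S a / ratio E x S a) - ln (1 + \<delta>) =
    (\<Sum>w\<in>S \<inter> nbrs E a. ln ((1 - ratio E x (child_set E S a w) w) /
       (1 - ratio E (\<lambda>v. (1 + \<delta>) * x v) (child_set E S a w) w)))"
proof -
  let ?y = "\<lambda>v. (1 + \<delta>) * x v" and ?N = "S \<inter> nbrs E a" and ?C = "child_set E S a"
  have px: "q_pos E V x"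
    by (rule q_pos_antimono[OF pos]) (use x d in \<open>auto simp: field_simps intro: less_imp_le mult_nonneg_nonneg\<close>)
  have lt: "ratio E x (?C w) w < 1" "ratio E ?y (?C w) w < 1" if "w \<in> ?N" for w
    using ratio_less_1[OF px child_set[OF S(1) that]] ratio_less_1[OF pos child_set[OF S(1) that]] .
  have xa: "x a > 0" using x S by auto
  have P: "0 < (\<Prod>w\<in>?N. 1 / (1 - ratio E x (?C w) w))" "0 < (\<Prod>w\<in>?N. 1 / (1 - ratio E ?y (?C w) w))"
    using lt by (auto intro!: prod_pos)
  have "ratio E ?y S a / ratio E x S a =
      (1 + \<delta>) * ((\<Prod>w\<in>?N. 1 / (1 - ratio E ?y (?C w) w)) / (\<Prod>w\<in>?N. 1 / (1 - ratio E x (?C w) w)))"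
    unfolding ratio_rec[OF px S] ratio_rec[OF pos S] using xa by simp
  also have "\<dots> = (1 + \<delta>) * (\<Prod>w\<in>?N. (1 - ratio E x (?C w) w) / (1 - ratio E ?y (?C w) w))"
    by (simp add: prod_dividef[symmetric])
  finally have eq: "ratio E ?y S a / ratio E x S a =
      (1 + \<delta>) * (\<Prod>w\<in>?N. (1 - ratio E x (?C w) w) / (1 - ratio E ?y (?C w) w))" .
  have "finite ?N" using finite_sub[OF S(1)] by simp
  moreover have f: "(1 - ratio E x (?C w) w) / (1 - ratio E ?y (?C w) w) > 0" if "w \<in> ?N" for w
    using lt[OF that] by simp
  ultimately have "ln (\<Prod>w\<in>?N. (1 - ratio E x (?C w) w) / (1 - ratio E ?y (?C w) w)) =
      (\<Sum>w\<in>?N. ln ((1 - ratio E x (?C w) w) / (1 - ratio E ?y (?C w) w)))"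
    by (intro ln_prod) (metis less_irrefl)+
  moreover have "0 < (\<Prod>w\<in>?N. (1 - ratio E x (?C w) w) / (1 - ratio E ?y (?C w) w))"
    by (rule prod_pos[OF f])
  ultimately show ?thesis unfolding eq using d by (subst ln_mult) auto
qed

text \<open>At depth 0 each child's error is at most \<open>1 / \<delta>\<close> times its share in
  the potential, because its ratio grows by a factor of at least \<open>1 + \<delta>\<close>. In the
  step the error is bounded by the children's errors with weights \<open>b / (1 - b)\<close>, and
  \<open>potential_contraction\<close> turns the weighted potentials of the children into
  \<open>1 - K / 3\<close> times the potential of the parent.\<close>

lemma ln_tree_val_error:
  fixes \<delta> K :: real
  assumes pos: "q_pos E V (\<lambda>v. (1 + \<delta>) * x v)" and x: "\<And>v. v \<in> V \<Longrightarrow> 0 < x v"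
    and K: "0 < K" "K\<^sup>2 \<le> \<delta>" "\<delta> \<le> 1"
    and S: "S \<subseteq> V" "a \<in> S"
  shows "ln (ratio E x S a / tree_val E x f S a) \<le> (1 - K / 3) ^ f / \<delta> *
    (ln (ratio E (\<lambda>v. (1 + \<delta>) * x v) S a / ratio E x S a) - ln (1 + \<delta>))"
  using S
proof (induction f arbitrary: S a)
  case (0 S a)
  let ?y = "\<lambda>v. (1 + \<delta>) * x v" and ?N = "S \<inter> nbrs E a" and ?C = "child_set E S a"
  have d0: "0 < \<delta>" using K by (smt (verit) zero_less_power)
  have px: "q_pos E V x"
    by (rule q_pos_antimono[OF pos]) (use x d0 in \<open>auto simp: field_simps intro: less_imp_le mult_nonneg_nonneg\<close>)
  have xa: "x a > 0" using x 0 by auto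
  have b: "0 < ratio E x (?C w) w" "ratio E x (?C w) w < 1" "ratio E ?y (?C w) w < 1"
     "(1 + \<delta>) * ratio E x (?C w) w \<le> ratio E ?y (?C w) w" if w: "w \<in> ?N" for w
    using ratio_less_1[OF px child_set[OF 0(1) w]] ratio_less_1[OF pos child_set[OF 0(1) w]]
      ratio_pos[OF px child_set[OF 0(1) w]] ratio_scale[OF pos _ _ child_set[OF 0(1) w], of x "1 + \<delta>"]
      x w 0 d0 by (auto simp: less_imp_le field_simps)
  have "ln (ratio E x S a / tree_val E x 0 S a) = ln (\<Prod>w\<in>?N. 1 / (1 - ratio E x (?C w) w))"
    unfolding ratio_rec[OF px 0] using xa by simp
  also have "\<dots> = (\<Sum>w\<in>?N. ln (1 / (1 - ratio E x (?C w) w)))"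
  proof (rule ln_prod)
    show "finite ?N" using finite_sub[OF 0(1)] by simp
    show "1 / (1 - ratio E x (?C w) w) \<noteq> 0" if "w \<in> ?N" for w using b[OF that] by simp
  qed
  also have "\<dots> \<le> (\<Sum>w\<in>?N. ln ((1 - ratio E x (?C w) w) / (1 - ratio E ?y (?C w) w)) / \<delta>)"
  proof (rule sum_mono)
    fix w assume w: "w \<in> ?N"
    let ?b = "ratio E x (?C w) w" and ?b' = "ratio E ?y (?C w) w"
    have w0: "0 < ?b / (1 - ?b)" using b[OF w] by simp
    have "\<delta> \<le> ?b' / ?b - 1" using b[OF w] by (simp add: field_simps)
    then have "?b / (1 - ?b) * \<delta> \<le> ?b / (1 - ?b) * (?b' / ?b - 1)"
      using w0 by (intro mult_left_mono) auto
    also have "\<dots> \<le> ln ((1 - ?b) / (1 - ?b'))" by (rule log_quotient_ge) (use b[OF w] in auto)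
    finally have "?b / (1 - ?b) \<le> ln ((1 - ?b) / (1 - ?b')) / \<delta>"
      using d0 by (simp add: pos_le_divide_eq)
    moreover have "ln (1 / (1 - ?b)) \<le> 1 / (1 - ?b) - 1"
      by (rule ln_le_minus_one) (use b[OF w] in simp)
    moreover have "1 / (1 - ?b) - 1 = ?b / (1 - ?b)" using b[OF w] by (simp add: field_simps)
    ultimately show "ln (1 / (1 - ?b)) \<le> ln ((1 - ?b) / (1 - ?b')) / \<delta>" by linarith
  qed
  also have "\<dots> = (\<Sum>w\<in>?N. ln ((1 - ratio E x (?C w) w) / (1 - ratio E ?y (?C w) w))) / \<delta>"
    by (simp only: sum_divide_distrib)
  also have "\<dots> = (1 - K / 3) ^ 0 / \<delta> * (ln (ratio E ?y S a / ratio E x S a) - ln (1 + \<delta>))"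
    using ln_ratio_scaled[OF pos x less_imp_le[OF d0] 0] by simp
  finally show ?case .
next
  case (Suc f S a)
  let ?y = "\<lambda>v. (1 + \<delta>) * x v" and ?N = "S \<inter> nbrs E a" and ?C = "child_set E S a"
  let ?t = "\<lambda>w. tree_val E x f (?C w) w"
  have d0: "0 < \<delta>" using K by (smt (verit) zero_less_power)
  have K1: "K \<le> 1" using K by (smt (verit) one_less_power pos2)
  have px: "q_pos E V x"
    by (rule q_pos_antimono[OF pos]) (use x d0 in \<open>auto simp: field_simps intro: less_imp_le mult_nonneg_nonneg\<close>)
  have xa: "x a > 0" using x Suc.prems by auto
  have b: "0 < ratio E x (?C w) w" "ratio E x (?C w) w < 1" "ratio E ?y (?C w) w < 1"
     "(1 + \<delta>) * ratio E x (?C w) w \<le> ratio E ?y (?C w) w"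
     "0 < ?t w" "?t w \<le> ratio E x (?C w) w" if w: "w \<in> ?N" for w
    using ratio_less_1[OF px child_set[OF Suc.prems(1) w]] ratio_less_1[OF pos child_set[OF Suc.prems(1) w]]
      ratio_pos[OF px child_set[OF Suc.prems(1) w]]
      ratio_scale[OF pos _ _ child_set[OF Suc.prems(1) w], of x "1 + \<delta>"]
      tree_val_le_ratio[OF px x child_set[OF Suc.prems(1) w], of f]
      x w Suc.prems d0 by (auto simp: less_imp_le field_simps)
  have "ratio E x S a / tree_val E x (Suc f) S a =
      (\<Prod>w\<in>?N. 1 / (1 - ratio E x (?C w) w)) / (\<Prod>w\<in>?N. 1 / (1 - ?t w))"
    unfolding ratio_rec[OF px Suc.prems] using xa by simp
  also have "\<dots> = (\<Prod>w\<in>?N. (1 - ?t w) / (1 - ratio E x (?C w) w))"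
    by (simp add: prod_dividef[symmetric])
  finally have "ln (ratio E x S a / tree_val E x (Suc f) S a) =
      ln (\<Prod>w\<in>?N. (1 - ?t w) / (1 - ratio E x (?C w) w))" by simp
  also have "\<dots> = (\<Sum>w\<in>?N. ln ((1 - ?t w) / (1 - ratio E x (?C w) w)))"
  proof (rule ln_prod)
    show "finite ?N" using finite_sub[OF Suc.prems(1)] by simp
    show "(1 - ?t w) / (1 - ratio E x (?C w) w) \<noteq> 0" if "w \<in> ?N" for w using b[OF that] by simp
  qed
  also have "\<dots> \<le> (\<Sum>w\<in>?N. (1 - K / 3) ^ Suc f / \<delta> *
      ln ((1 - ratio E x (?C w) w) / (1 - ratio E ?y (?C w) w)))"
  proof (rule sum_mono)
    fix w assume w: "w \<in> ?N"
    let ?b = "ratio E x (?C w) w" and ?b' = "ratio E ?y (?C w) w"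
    have w0: "0 < ?b / (1 - ?b)" using b[OF w] by simp
    \<comment> \<open>Two tangent bounds for \<open>ln\<close> put the weight
      \<open>?b / (1 - ?b)\<close> on the child's error \<open>ln (?b / ?t w)\<close>.\<close>
    have "ln ((1 - ?t w) / (1 - ?b)) \<le> (1 - ?t w) / (1 - ?b) - 1"
      by (rule ln_le_minus_one) (use b[OF w] in simp)
    also have "\<dots> = ?b / (1 - ?b) * (1 - ?t w / ?b)" using b[OF w] by (simp add: field_simps)
    also have "\<dots> \<le> ?b / (1 - ?b) * ln (?b / ?t w)"
    proof (rule mult_left_mono)
      have "ln (?t w / ?b) \<le> ?t w / ?b - 1" by (rule ln_le_minus_one) (use b[OF w] in simp)
      then show "1 - ?t w / ?b \<le> ln (?b / ?t w)" using b[OF w] by (simp add: ln_div)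
    qed (use w0 in simp)
    also have "\<dots> \<le> ?b / (1 - ?b) * ((1 - K / 3) ^ f / \<delta> * (ln (?b' / ?b) - ln (1 + \<delta>)))"
      using w0 by (intro mult_left_mono Suc.IH child_set[OF Suc.prems(1) w]) auto
    also have "\<dots> = (1 - K / 3) ^ f / \<delta> * (?b / (1 - ?b) * (ln (?b' / ?b) - ln (1 + \<delta>)))"
      by (simp add: mult_ac)
    also have "\<dots> \<le> (1 - K / 3) ^ f / \<delta> * ((1 - K / 3) * ln ((1 - ?b) / (1 - ?b')))"
      using b[OF w] K K1 d0 by (intro mult_left_mono potential_contraction) auto
    finally show "ln ((1 - ?t w) / (1 - ?b)) \<le> (1 - K / 3) ^ Suc f / \<delta> * ln ((1 - ?b) / (1 - ?b'))"
      by (simp add: mult_ac)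
  qed
  also have "\<dots> = (1 - K / 3) ^ Suc f / \<delta> *
      (\<Sum>w\<in>?N. ln ((1 - ratio E x (?C w) w) / (1 - ratio E ?y (?C w) w)))"
    by (simp only: sum_distrib_left)
  also have "\<dots> = (1 - K / 3) ^ Suc f / \<delta> * (ln (ratio E ?y S a / ratio E x S a) - ln (1 + \<delta>))"
    using ln_ratio_scaled[OF pos x less_imp_le[OF d0] Suc.prems] by simp
  finally show ?case .
qed

text \<open>At \<open>s p\<close> the truncated value at \<open>v\<close> is at least
  \<open>(1 - \<alpha> / 4) * (1 - \<alpha> / 7)\<close>, the first loss being due to truncation,
  the second to the ratio. If the tree at \<open>(1 + \<alpha>) p\<close> did not fail,
  \<open>tree_val_mono\<close> would lift this to a value of at least 1 there.\<close>

lemma exists_failing_tree: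
  fixes \<alpha> K :: real
  assumes p: "\<And>v. v \<in> V \<Longrightarrow> 0 < p v" and npos: "\<not> q_pos E V p"
    and \<alpha>: "0 < \<alpha>" "\<alpha> \<le> 1" and K: "0 < K" "K\<^sup>2 \<le> \<alpha> / (8 * real (card V))"
    and l: "(1 - K / 3) ^ l * (32 * real (card V)) \<le> \<alpha>\<^sup>2"
  shows "\<exists>v\<in>V. \<not> tree_ok E (\<lambda>v. (1 + \<alpha>) * p v) l V v"
proof -
  define \<delta> where "\<delta> = \<alpha> / (8 * real (card V))"
  obtain t where t: "0 < t" "t \<le> 1" "q_poly E V (\<lambda>v. t * p v) = 0"
    "\<And>s. 0 \<le> s \<Longrightarrow> s < t \<Longrightarrow> q_pos E V (\<lambda>v. s * p v)"
    using first_zero[of p] p npos by (metis less_imp_le)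
  have "V \<noteq> {}" using t(3) by auto
  then have n: "card V \<ge> 1" using finite_V by (simp add: Suc_leI card_gt_0_iff)
  have d: "0 < \<delta>" "\<delta> * card V = \<alpha> / 8" using \<alpha> n by (auto simp: \<delta>_def)
  have "\<delta> * 1 \<le> \<delta> * card V" using d n by (intro mult_left_mono) auto
  then have d1: "\<delta> \<le> 1 / 8" using d \<alpha> by simp
  \<comment> \<open>Then \<open>(1 + \<delta>) * s = (1 - \<delta>\<^sup>2) * t < t\<close>, so the
    dilated point still precedes the first zero.\<close>
  define s where "s = (1 - \<delta>) * t"
  have s: "0 < s" "s < t" "7 / 8 * t \<le> s" "s \<le> 1"
    using t d d1 by (auto simp: s_def mult_left_le_one_le intro!: mult_le_one)
  let ?x = "\<lambda>v. s * p v" and ?y = "\<lambda>v. (1 + \<delta>) * (s * p v)"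
  have "(1 + \<delta>) * s = t - \<delta>\<^sup>2 * t" by (simp add: s_def power2_eq_square algebra_simps)
  moreover have "0 < \<delta>\<^sup>2 * t" using d t by simp
  moreover have "0 \<le> (1 + \<delta>) * s" using s d by simp
  ultimately have "q_pos E V (\<lambda>v. ((1 + \<delta>) * s) * p v)" by (intro t(4)) linarith+
  then have py: "q_pos E V ?y" by (simp add: mult.assoc)
  have px: "q_pos E V ?x" using t(4) s by auto
  have x0: "\<And>v. v \<in> V \<Longrightarrow> 0 < ?x v" using s p by simp
  obtain v where v: "v \<in> V" "s * (1 - ratio E ?x V v) \<le> card V * (t - s) * ratio E ?x V v"
    using exists_large_ratio[of p s t] p s t by (force intro: less_imp_le)
  let ?b = "ratio E ?x V v" and ?b' = "ratio E ?y V v" and ?t = "tree_val E ?x l V v"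
  have b: "0 < ?b" "?b < 1" "0 < ?b'" "?b' < 1" "0 < ?t"
    using ratio_pos[OF px subset_refl v(1)] ratio_pos[OF py subset_refl v(1)] x0 v d
      ratio_less_1[OF px subset_refl v(1)] ratio_less_1[OF py subset_refl v(1)]
      tree_val_le_ratio[OF px x0 subset_refl v(1)] by auto
  \<comment> \<open>Here \<open>t - s = \<delta> * t\<close> and
    \<open>\<delta> * card V = \<alpha> / 8\<close>, which leads to
    \<open>7 * (1 - ?b) \<le> \<alpha>\<close>.\<close>
  have "7 / 8 * t * (1 - ?b) \<le> s * (1 - ?b)" using s b by (intro mult_right_mono) auto
  also have "\<dots> \<le> card V * (t - s) * ?b" by (rule v(2))
  also have "\<dots> = \<alpha> / 8 * t * ?b" unfolding d(2)[symmetric] by (simp add: s_def algebra_simps)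
  also have "\<dots> \<le> \<alpha> / 8 * t" using b \<alpha> t by (simp add: mult_left_le)
  finally have "t * (7 * (1 - ?b)) \<le> t * \<alpha>" by (simp add: algebra_simps)
  then have b7: "1 - \<alpha> / 7 \<le> ?b" using t(1) by simp
  \<comment> \<open>The potential at the root is at most 1, since \<open>?b' < 1\<close> and
    \<open>?b \<ge> 6 / 7\<close>.\<close>
  have "ln (?b' / ?b) \<le> ln (1 / ?b)" using b by (intro ln_mono) (auto simp: divide_right_mono)
  also have "\<dots> \<le> 1 / ?b - 1" by (rule ln_le_minus_one) (use b in simp)
  also have "\<dots> \<le> 1" using b b7 \<alpha> by (simp add: field_simps)
  finally have H: "ln (?b' / ?b) - ln (1 + \<delta>) \<le> 1" using d ln_ge_zero[of "1 + \<delta>"] by linarith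
  have K1: "K \<le> 1"
  proof (rule ccontr)
    assume "\<not> ?thesis"
    then have "1 < K\<^sup>2" by (intro one_less_power) auto
    then show False using K(2) d1 by (simp add: \<delta>_def)
  qed
  have "(1 - K / 3) ^ l * 32 * card V * \<alpha> \<le> \<alpha>\<^sup>2 * \<alpha>"
    using l \<alpha> by (intro mult_right_mono) (auto simp: mult.assoc)
  then have c: "(1 - K / 3) ^ l / \<delta> \<le> \<alpha> / 4"
    using \<alpha> n l by (simp add: \<delta>_def field_simps power2_eq_square)
  have c0: "0 \<le> (1 - K / 3) ^ l / \<delta>" using K1 d by simp
  have "ln (?b / ?t) \<le> (1 - K / 3) ^ l / \<delta> * (ln (?b' / ?b) - ln (1 + \<delta>))"
    by (rule ln_tree_val_error[OF py x0 K(1) _ _ subset_refl v(1)]) (use K d1 in \<open>auto simp: \<delta>_def\<close>)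
  also have "\<dots> \<le> (1 - K / 3) ^ l / \<delta> * 1" by (rule mult_left_mono[OF H c0])
  finally have e: "ln (?b / ?t) \<le> \<alpha> / 4" using c by linarith
  have "ln (?t / ?b) = - ln (?b / ?t)" using b by (simp add: ln_div)
  moreover have "ln (?t / ?b) \<le> ?t / ?b - 1" by (rule ln_le_minus_one) (use b in simp)
  ultimately have "1 - \<alpha> / 4 \<le> ?t / ?b" using e by linarith
  then have "(1 - \<alpha> / 4) * ?b \<le> ?t" using b by (simp add: pos_le_divide_eq)
  moreover have "(1 - \<alpha> / 4) * (1 - \<alpha> / 7) \<le> (1 - \<alpha> / 4) * ?b"
    using b7 \<alpha> by (intro mult_left_mono) auto
  ultimately have "(1 - \<alpha> / 4) * (1 - \<alpha> / 7) \<le> ?t" by linarith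
  then have "(1 + \<alpha>) * ((1 - \<alpha> / 4) * (1 - \<alpha> / 7)) \<le> (1 + \<alpha>) * ?t"
    using \<alpha> by (intro mult_left_mono) auto
  \<comment> \<open>For \<open>\<alpha> \<le> 1\<close> the factor \<open>1 + \<alpha>\<close>
    outweighs both losses.\<close>
  moreover have "1 \<le> (1 + \<alpha>) * ((1 - \<alpha> / 4) * (1 - \<alpha> / 7))"
  proof -
    have "(1 + \<alpha>) * ((1 - \<alpha> / 4) * (1 - \<alpha> / 7)) - 1 = \<alpha> * (7 + 10 * (1 - \<alpha>) + \<alpha>\<^sup>2) / 28"
      by (simp add: field_simps power2_eq_square)
    moreover have "0 \<le> \<alpha> * (7 + 10 * (1 - \<alpha>) + \<alpha>\<^sup>2) / 28" using \<alpha> by simp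
    ultimately show ?thesis by linarith
  qed
  ultimately have ge: "1 \<le> (1 + \<alpha>) * ?t" by linarith
  have "\<not> tree_ok E (\<lambda>v. (1 + \<alpha>) * p v) l V v"
  proof
    assume ok: "tree_ok E (\<lambda>v. (1 + \<alpha>) * p v) l V v"
    have "(1 + \<alpha>) * ?t \<le> tree_val E (\<lambda>v. (1 + \<alpha>) * p v) l V v"
      by (rule tree_val_mono[THEN conjunct2, OF _ _ _ subset_refl v(1) ok])
         (use \<alpha> p s in \<open>auto simp: mult_left_le_one_le intro: less_imp_le\<close>)
    then show False using ge tree_ok_less_1[OF ok] by linarith
  qed
  then show ?thesis using v(1) by blast
qed

end

section \<open>Loops with loop-free bodies\<close>

primrec loop_free :: "com \<Rightarrow> bool" where
  "loop_free Skip \<longleftrightarrow> True"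
| "loop_free (NSet x i a) \<longleftrightarrow> True"
| "loop_free (RSet x i a) \<longleftrightarrow> True"
| "loop_free (Seq c1 c2) \<longleftrightarrow> loop_free c1 \<and> loop_free c2"
| "loop_free (Cond b c1 c2) \<longleftrightarrow> loop_free c1 \<and> loop_free c2"
| "loop_free (While b c) \<longleftrightarrow> False"

text \<open>The clauses for \<open>While\<close> in \<open>exec\<close> and \<open>cost_bound\<close> are junk; both are used for loop-free commands only.\<close>

primrec exec :: "com \<Rightarrow> state \<Rightarrow> state" where
  "exec Skip s = s"
| "exec (NSet x i a) s = nupd x (nval s i) (nval s a) s"
| "exec (RSet x i a) s = rupd x (nval s i) (rval s a) s"
| "exec (Seq c1 c2) s = exec c2 (exec c1 s)"
| "exec (Cond b c1 c2) s = (if bval s b then exec c1 s else exec c2 s)"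
| "exec (While b c) s = s"

primrec cost_bound :: "com \<Rightarrow> nat" where
  "cost_bound Skip = 1"
| "cost_bound (NSet x i a) = 1 + ncost i + ncost a"
| "cost_bound (RSet x i a) = 1 + ncost i + rcost a"
| "cost_bound (Seq c1 c2) = cost_bound c1 + cost_bound c2"
| "cost_bound (Cond b c1 c2) = 1 + bcost b + (cost_bound c1 + cost_bound c2)"
| "cost_bound (While b c) = 0"

lemma runs_loop_free:
  "loop_free c \<Longrightarrow> \<exists>t. runs c s t (exec c s) \<and> t \<le> cost_bound c"
proof (induction c arbitrary: s)
  case (Seq c1 c2)
  obtain t1 t2 where "runs c1 s t1 (exec c1 s)" "t1 \<le> cost_bound c1"
    "runs c2 (exec c1 s) t2 (exec c2 (exec c1 s))" "t2 \<le> cost_bound c2"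
    using Seq by fastforce
  then show ?case by (auto intro!: exI[of _ "t1 + t2"] intro: runs.Seq)
next
  case (Cond b c1 c2)
  show ?case
  proof (cases "bval s b")
    case True
    obtain t where "runs c1 s t (exec c1 s)" "t \<le> cost_bound c1" using Cond by fastforce
    with True show ?thesis
      by (auto intro!: exI[of _ "1 + bcost b + t"] runs.CondTrue simp del: One_nat_def simp: trans_le_add1)
  next
    case False
    obtain t where "runs c2 s t (exec c2 s)" "t \<le> cost_bound c2" using Cond by fastforce
    with False show ?thesis
      by (auto intro!: exI[of _ "1 + bcost b + t"] runs.CondFalse simp del: One_nat_def simp: trans_le_add2)
  qed
qed (auto intro: runs.intros exI)

text \<open>The guard must hold before each of the \<open>m\<close> steps, while the end is left
  open so that partial runs can be concatenated.\<close>

definition reaches :: "('s \<Rightarrow> bool) \<Rightarrow> ('s \<Rightarrow> 's) \<Rightarrow> 's \<Rightarrow> nat \<Rightarrow> 's \<Rightarrow> bool" where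
  "reaches g f s m s' \<longleftrightarrow> s' = (f ^^ m) s \<and> (\<forall>i<m. g ((f ^^ i) s))"

lemma reaches_refl: "reaches g f s 0 s"
  by (simp add: reaches_def)

lemma reaches_step: "g s \<Longrightarrow> reaches g f s 1 (f s)"
  by (simp add: reaches_def)

lemma reaches_trans:
  assumes "reaches g f s m s'" "reaches g f s' k s''"
  shows "reaches g f s (m + k) s''"
proof -
  have *: "(f ^^ (m + i)) s = (f ^^ i) s'" for i
    using assms(1) by (simp add: reaches_def add.commute[of m] funpow_add)
  have "g ((f ^^ i) s)" if "i < m + k" for i
  proof (cases "i < m")
    case False
    then show ?thesis using assms(2) that *[of "i - m"] by (simp add: reaches_def)
  qed (use assms in \<open>simp add: reaches_def\<close>)
  then show ?thesis using assms(2) *[of k] by (simp add: reaches_def)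
qed

lemma reaches_Suc:
  assumes "\<And>i. i < m \<Longrightarrow> g i"
  shows "reaches g Suc 0 m m"
proof -
  have "(Suc ^^ i) 0 = i" for i by (induction i) auto
  then show ?thesis using assms by (simp add: reaches_def)
qed

text \<open>Depends only on the text of the loop, hence is a constant for a fixed program; 0 is a
  default for other commands.\<close>

definition iter_cost :: "com \<Rightarrow> nat" where
  "iter_cost c = (case c of While b c' \<Rightarrow> 1 + bcost b + cost_bound c' | _ \<Rightarrow> 0)"

text \<open>\<open>R\<close> simulates the abstract transition \<open>f\<close> with guard
  \<open>g\<close>. The summand 1 in \<open>m + 1\<close> pays for the last, failing test of the
  guard.\<close>

lemma runs_While:
  assumes "loop_free c"
    and sim: "\<And>s \<sigma>. R s \<sigma> \<Longrightarrow> bval s b \<longleftrightarrow> g \<sigma>"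
      "\<And>s \<sigma>. R s \<sigma> \<Longrightarrow> g \<sigma> \<Longrightarrow> R (exec c s) (f \<sigma>)"
    and "R s \<sigma>" "reaches g f \<sigma> m \<sigma>'" "\<not> g \<sigma>'"
  shows "\<exists>t s'. runs (While b c) s t s' \<and> R s' \<sigma>' \<and> t \<le> (m + 1) * iter_cost (While b c)"
  unfolding iter_cost_def com.case using assms(4,5)
proof (induction m arbitrary: s \<sigma>)
  case 0
  then have "\<sigma>' = \<sigma>" by (simp add: reaches_def)
  then show ?case
    using 0 sim(1)[OF 0(1)] assms(6) by (auto intro!: exI[of _ "1 + bcost b"] exI[of _ s] runs.WhileFalse simp del: One_nat_def)
next
  case (Suc m)
  have g: "g \<sigma>" using Suc.prems(2) unfolding reaches_def by (metis funpow_0 zero_less_Suc)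
  have "reaches g f (f \<sigma>) m \<sigma>'"
    using Suc.prems(2) unfolding reaches_def by (metis Suc_less_eq comp_apply funpow_Suc_right)
  from Suc.IH[OF sim(2)[OF Suc.prems(1) g] this] obtain t2 s' where
    2: "runs (While b c) (exec c s) t2 s'" "R s' \<sigma>'" "t2 \<le> (m + 1) * (1 + bcost b + cost_bound c)" by blast
  obtain t1 where 1: "runs c s t1 (exec c s)" "t1 \<le> cost_bound c" using runs_loop_free[OF assms(1)] by blast
  have "runs (While b c) s (1 + bcost b + t1 + t2) s'"
    using runs.WhileTrue[OF _ 1(1) 2(1)] sim(1)[OF Suc.prems(1)] g by blast
  moreover have "1 + bcost b + t1 + t2 \<le> (Suc m + 1) * (1 + bcost b + cost_bound c)"
    using 1(2) 2(3) by simp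
  ultimately show ?case using 2(2) by blast
qed

section \<open>Depth-first evaluation of the truncated recursion\<close>

text \<open>
  Stack frames are numbered from \<open>1\<close> to \<open>depth\<close>. The frame of a vertex scans positions \<open>0, \<dots>, n - 1\<close>
  for children; \<open>mark u\<close> is the frame that removed \<open>u\<close> from the current vertex set, \<open>0\<close> if none did.
  On positions \<open>n, \<dots>, 2 n - 1\<close> the frame clears its marks, so that a step needs no inner loop.
  The product \<open>prd\<close> of a frame collects the factors of its finished children.
\<close>

record config =
  depth :: nat
  root :: nat
  vert :: "nat \<Rightarrow> nat"
  posn :: "nat \<Rightarrow> nat"
  mark :: "nat \<Rightarrow> nat"
  prd :: "nat \<Rightarrow> real"
  bad :: bool

locale search =
  fixes n :: nat and E :: "nat set set" and x :: "nat \<Rightarrow> real" and lim D :: nat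
  assumes no_loop: "\<And>a. {a} \<notin> E"
    and degree: "\<And>a. a < n \<Longrightarrow> card ({..<n} \<inter> nbrs E a) \<le> D" and D: "1 \<le> D"
begin

definition active :: "config \<Rightarrow> bool" where
  "active \<sigma> \<longleftrightarrow> 0 < depth \<sigma> \<or> root \<sigma> < n"

definition start :: "config \<Rightarrow> config" where
  "start \<sigma> = \<sigma>\<lparr>depth := 1, root := root \<sigma> + 1, vert := (vert \<sigma>)(1 := root \<sigma>),
     posn := (posn \<sigma>)(1 := 0), mark := (mark \<sigma>)(root \<sigma> := 1), prd := (prd \<sigma>)(1 := 1)\<rparr>"

definition descends :: "config \<Rightarrow> bool" where
  "descends \<sigma> \<longleftrightarrow> depth \<sigma> < lim \<and> {vert \<sigma> (depth \<sigma>), posn \<sigma> (depth \<sigma>)} \<in> E \<and>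
     mark \<sigma> (posn \<sigma> (depth \<sigma>)) = 0"

text \<open>The child \<open>j\<close> is marked with the frame of its parent, so it stays removed
  while later siblings are evaluated, as \<open>child_set\<close> demands. The parent's position
  advances now, so that it resumes behind \<open>j\<close>.\<close>

definition push :: "config \<Rightarrow> config" where
  "push \<sigma> = (let k = depth \<sigma>; j = posn \<sigma> k in
     \<sigma>\<lparr>depth := k + 1, vert := (vert \<sigma>)(k + 1 := j), posn := (posn \<sigma>)(k + 1 := 0, k := j + 1),
       mark := (mark \<sigma>)(j := k), prd := (prd \<sigma>)(k + 1 := 1)\<rparr>)"

definition advance :: "config \<Rightarrow> config" where
  "advance \<sigma> = \<sigma>\<lparr>posn := (posn \<sigma>)(depth \<sigma> := posn \<sigma> (depth \<sigma>) + 1)\<rparr>"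

definition unmark :: "config \<Rightarrow> config" where
  "unmark \<sigma> = (let k = depth \<sigma>; u = posn \<sigma> k - n in
     if mark \<sigma> u = k then \<sigma>\<lparr>mark := (mark \<sigma>)(u := 0)\<rparr> else \<sigma>)"

text \<open>Frame 0 acts as a dummy parent, so roots are popped like all other vertices.\<close>

definition pop :: "config \<Rightarrow> config" where
  "pop \<sigma> = (let k = depth \<sigma>; v = x (vert \<sigma> k) * prd \<sigma> k in
     \<sigma>\<lparr>depth := k - 1, prd := (prd \<sigma>)(k - 1 := prd \<sigma> (k - 1) / (1 - v)), bad := (bad \<sigma> \<or> \<not> v < 1)\<rparr>)"

definition step :: "config \<Rightarrow> config" where
  "step \<sigma> =
    (if depth \<sigma> = 0 then start \<sigma>
     else if posn \<sigma> (depth \<sigma>) < n then (if descends \<sigma> then push \<sigma> else advance \<sigma>)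
     else if posn \<sigma> (depth \<sigma>) < n + n then advance (unmark \<sigma>)
     else pop \<sigma>)"

text \<open>A frame takes \<open>n\<close> scanning steps, \<open>n\<close> clearing steps and one
  pop, besides the steps of at most \<open>D\<close> children. The base \<open>2 * D\<close> absorbs
  the frame's own steps.\<close>

definition frame_cost :: "nat \<Rightarrow> nat" where
  "frame_cost f = (2 * n + 1) * (2 * D) ^ f"

section \<open>Specification of a single frame\<close>

abbreviation "go \<equiv> reaches active step"

text \<open>Empty at depth 0, so that \<open>tree_val\<close> and \<open>tree_ok\<close> obey one
  formula for all depths.\<close>

definition children :: "nat \<Rightarrow> nat set \<Rightarrow> nat \<Rightarrow> nat set" where
  "children f S a = (if f = 0 then {} else S \<inter> nbrs E a)"

text \<open>Invariant of the scanning phase at position \<open>j\<close>. Cells above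
  \<open>depth \<sigma>\<close> are left open, since deeper frames overwrite them.\<close>

definition scanned :: "nat \<Rightarrow> nat set \<Rightarrow> nat \<Rightarrow> config \<Rightarrow> nat \<Rightarrow> config \<Rightarrow> bool" where
  "scanned f S a \<sigma> j \<tau> \<longleftrightarrow> depth \<tau> = depth \<sigma> \<and> root \<tau> = root \<sigma> \<and>
    (\<forall>i\<le>depth \<sigma>. vert \<tau> i = vert \<sigma> i) \<and> (\<forall>i<depth \<sigma>. posn \<tau> i = posn \<sigma> i) \<and> posn \<tau> (depth \<sigma>) = j \<and>
    (\<forall>u. mark \<tau> u = (if u \<in> children f S a \<inter> {..<j} then depth \<sigma> else mark \<sigma> u)) \<and>
    (\<forall>i<depth \<sigma>. prd \<tau> i = prd \<sigma> i) \<and>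
    prd \<tau> (depth \<sigma>) = (\<Prod>w\<in>children f S a \<inter> {..<j}. 1 / (1 - tree_val E x (f - 1) (child_set E S a w) w)) \<and>
    (bad \<tau> \<longleftrightarrow> bad \<sigma> \<or> (\<exists>w\<in>children f S a \<inter> {..<j}. \<not> tree_ok E x (f - 1) (child_set E S a w) w))"

definition evaluated :: "nat \<Rightarrow> nat set \<Rightarrow> nat \<Rightarrow> config \<Rightarrow> config \<Rightarrow> bool" where
  "evaluated f S a \<sigma> \<tau> \<longleftrightarrow> depth \<tau> = depth \<sigma> - 1 \<and> root \<tau> = root \<sigma> \<and>
    (\<forall>i<depth \<sigma>. vert \<tau> i = vert \<sigma> i) \<and> (\<forall>i<depth \<sigma>. posn \<tau> i = posn \<sigma> i) \<and>
    (\<forall>u. mark \<tau> u = (if u < n \<and> mark \<sigma> u = depth \<sigma> then 0 else mark \<sigma> u)) \<and>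
    (\<forall>i<depth \<sigma> - 1. prd \<tau> i = prd \<sigma> i) \<and>
    prd \<tau> (depth \<sigma> - 1) = prd \<sigma> (depth \<sigma> - 1) / (1 - tree_val E x f S a) \<and>
    (bad \<tau> \<longleftrightarrow> bad \<sigma> \<or> \<not> tree_ok E x f S a)"

text \<open>Situation at the entry of a frame with \<open>f\<close> levels left. The vertex
  \<open>a\<close> is already marked, by its parent or, for a root, by its own frame 1; hence
  \<open>S\<close> is \<open>a\<close> together with the unmarked vertices.\<close>

definition at_frame :: "nat \<Rightarrow> nat set \<Rightarrow> nat \<Rightarrow> config \<Rightarrow> bool" where
  "at_frame f S a \<sigma> \<longleftrightarrow> 0 < depth \<sigma> \<and> depth \<sigma> + f = lim \<and> vert \<sigma> (depth \<sigma>) = a \<and> a < n \<and>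
     posn \<sigma> (depth \<sigma>) = 0 \<and> prd \<sigma> (depth \<sigma>) = 1 \<and> mark \<sigma> a \<noteq> 0 \<and>
     (\<forall>u. mark \<sigma> u \<le> depth \<sigma>) \<and> S = insert a {u\<in>{..<n}. mark \<sigma> u = 0}"

lemma child_iff:
  assumes "at_frame f S a \<sigma>" "j < n"
  shows "j \<in> children f S a \<longleftrightarrow> depth \<sigma> < lim \<and> {a, j} \<in> E \<and> mark \<sigma> j = 0"
  using assms no_loop[of a] unfolding at_frame_def children_def by (auto simp: nbrs_def)

lemma lessThan_Suc_child: "C \<inter> {..<Suc j} = (if j \<in> C then insert j (C \<inter> {..<j}) else C \<inter> {..<j})"
  by (auto simp: less_Suc_eq)

lemma child_frame:
  assumes fr: "at_frame f S a \<sigma>" and sc: "scanned f S a \<sigma> j \<tau>" and j: "j < n" "j \<in> children f S a"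
  shows "at_frame (f - 1) (child_set E S a j) j (push \<tau>)"
proof -
  have f: "0 < f" using j(2) by (cases f) (auto simp: children_def)
  have C: "children f S a = {u\<in>{..<n}. mark \<sigma> u = 0} \<inter> nbrs E a"
    using fr f no_loop[of a] unfolding at_frame_def children_def nbrs_def by auto
  have "child_set E S a j = insert j {u\<in>{..<n}. mark (push \<tau>) u = 0}"
    using fr sc j f unfolding at_frame_def scanned_def push_def Let_def C child_set_def
    by (auto split: if_splits)
  then show ?thesis
    using fr sc j f unfolding at_frame_def scanned_def push_def Let_def by (auto simp: le_Suc_eq)
qed

lemma scanned_push:
  assumes fr: "at_frame f S a \<sigma>" and sc: "scanned f S a \<sigma> j \<tau>" and j: "j < n" "j \<in> children f S a"
    and ev: "evaluated (f - 1) (child_set E S a j) j (push \<tau>) \<rho>"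
  shows "scanned f S a \<sigma> (Suc j) \<rho>"
proof -
  have k: "depth \<tau> = depth \<sigma>" using sc by (simp add: scanned_def)
  have fin: "finite (children f S a)" using fr by (simp add: at_frame_def children_def)
  \<comment> \<open>The child's frame clears only marks equal to \<open>depth \<sigma> + 1\<close>,
    and there are none at its entry, so it changes no marks in the end.\<close>
  have le: "mark (push \<tau>) u \<le> depth \<sigma>" for u
    using fr sc unfolding at_frame_def scanned_def push_def Let_def by simp
  have "mark \<rho> u = mark (push \<tau>) u" for u
    using ev le[of u] k unfolding evaluated_def by (simp add: push_def Let_def)
  then have m: "mark \<rho> u = (if u \<in> children f S a \<inter> {..<Suc j} then depth \<sigma> else mark \<sigma> u)" for u
    using sc j unfolding scanned_def push_def Let_def by (auto simp: less_Suc_eq)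
  show ?thesis
    unfolding scanned_def lessThan_Suc_child if_P[OF j(2)]
    using m[unfolded lessThan_Suc_child if_P[OF j(2)]] ev sc k fin
    unfolding evaluated_def scanned_def push_def Let_def by auto
qed

lemma scanned_advance:
  assumes "scanned f S a \<sigma> j \<tau>" "j \<notin> children f S a"
  shows "scanned f S a \<sigma> (Suc j) (advance \<tau>)"
  using assms unfolding scanned_def lessThan_Suc_child if_not_P[OF assms(2)] advance_def by simp

section \<open>Correctness and step count of the search\<close>

lemma card_children:
  assumes "at_frame f S a \<sigma>"
  shows "finite (children f S a)" "card (children f S a) \<le> D" "children f S a \<subseteq> {..<n}"
proof -
  have a: "a < n" and S: "S \<subseteq> {..<n}" using assms by (auto simp: at_frame_def)
  show sub: "children f S a \<subseteq> {..<n}" using S by (auto simp: children_def)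
  then show "finite (children f S a)" using finite_subset by blast
  have "children f S a \<subseteq> {..<n} \<inter> nbrs E a" using S by (auto simp: children_def)
  then have "card (children f S a) \<le> card ({..<n} \<inter> nbrs E a)" by (intro card_mono) auto
  then show "card (children f S a) \<le> D" using degree[OF a] by linarith
qed

lemma scan:
  assumes fr: "at_frame f S a \<sigma>"
    and IH: "\<And>S' b \<tau>. 0 < f \<Longrightarrow> at_frame (f - 1) S' b \<tau> \<Longrightarrow>
      \<exists>m \<rho>. go \<tau> m \<rho> \<and> m \<le> frame_cost (f - 1) \<and> evaluated (f - 1) S' b \<tau> \<rho>"
    and "j \<le> n"
  shows "\<exists>m \<tau>. go \<sigma> m \<tau> \<and> m \<le> j + card (children f S a \<inter> {..<j}) * frame_cost (f - 1) \<and> scanned f S a \<sigma> j \<tau>"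
  using assms(3)
proof (induction j)
  case 0
  have "scanned f S a \<sigma> 0 \<sigma>" using fr by (simp add: scanned_def at_frame_def)
  then show ?case using reaches_refl by fastforce
next
  case (Suc j)
  then obtain m \<tau> where m: "go \<sigma> m \<tau>" "m \<le> j + card (children f S a \<inter> {..<j}) * frame_cost (f - 1)"
    and sc: "scanned f S a \<sigma> j \<tau>" by auto
  have k: "depth \<tau> = depth \<sigma>" "0 < depth \<sigma>" "posn \<tau> (depth \<tau>) = j" "vert \<tau> (depth \<tau>) = a"
    using sc fr by (auto simp: scanned_def at_frame_def)
  have act: "active \<tau>" using k by (simp add: active_def)
  have jn: "j < n" using Suc by simp
  have "mark \<tau> j = mark \<sigma> j" using sc by (simp add: scanned_def)
  then have desc: "descends \<tau> \<longleftrightarrow> j \<in> children f S a"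
    unfolding descends_def child_iff[OF fr jn] k using k by simp
  show ?case
  proof (cases "j \<in> children f S a")
    case True
    have f: "0 < f" using True by (cases f) (auto simp: children_def)
    obtain m' \<rho> where m': "go (push \<tau>) m' \<rho>" "m' \<le> frame_cost (f - 1)"
      "evaluated (f - 1) (child_set E S a j) j (push \<tau>) \<rho>"
      using IH[OF f child_frame[OF fr sc jn True]] by blast
    have "step \<tau> = push \<tau>" using True desc jn k by (simp add: step_def)
    then have "go \<tau> 1 (push \<tau>)" using reaches_step[of active \<tau> step] act by simp
    then have "go \<sigma> (m + (1 + m')) \<rho>" using reaches_trans m(1) m'(1) by metis
    moreover have "m + (1 + m') \<le> Suc j + card (children f S a \<inter> {..<Suc j}) * frame_cost (f - 1)"
      using m(2) m'(2) True by (simp add: lessThan_Suc_child)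
    ultimately show ?thesis using scanned_push[OF fr sc jn True m'(3)] by blast
  next
    case False
    have "step \<tau> = advance \<tau>" using False desc jn k by (simp add: step_def)
    then have "go \<tau> 1 (advance \<tau>)" using reaches_step[of active \<tau> step] act by simp
    then have "go \<sigma> (m + 1) (advance \<tau>)" using reaches_trans m(1) by metis
    moreover have "m + 1 \<le> Suc j + card (children f S a \<inter> {..<Suc j}) * frame_cost (f - 1)"
      using m(2) False by (simp add: lessThan_Suc_child)
    ultimately show ?thesis using scanned_advance[OF sc False] by blast
  qed
qed

lemma unmark_scan:
  assumes "0 < depth \<tau>" "posn \<tau> (depth \<tau>) = n" "i \<le> n"
  shows "go \<tau> i (\<tau>\<lparr>posn := (posn \<tau>)(depth \<tau> := n + i),
    mark := (\<lambda>u. if u < i \<and> mark \<tau> u = depth \<tau> then 0 else mark \<tau> u)\<rparr>)"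
  using assms(3)
proof (induction i)
  case 0
  have "(posn \<tau>)(depth \<tau> := n) = posn \<tau>" using assms(2) by auto
  then show ?case using reaches_refl by (simp add: reaches_refl)
next
  case (Suc i)
  let ?c = "\<lambda>i. \<tau>\<lparr>posn := (posn \<tau>)(depth \<tau> := n + i),
    mark := (\<lambda>u. if u < i \<and> mark \<tau> u = depth \<tau> then 0 else mark \<tau> u)\<rparr>"
  have "step (?c i) = advance (unmark (?c i))" using assms Suc by (simp add: step_def)
  also have "\<dots> = ?c (Suc i)"
    using assms(1) by (auto simp: advance_def unmark_def Let_def less_Suc_eq fun_eq_iff)
  finally have "go (?c i) 1 (?c (Suc i))"
    using reaches_step[of active "?c i" step] assms by (simp add: active_def)
  from reaches_trans[OF Suc.IH this] Suc.prems show ?case by (simp add: fun_upd_def)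
qed

lemma evaluate:
  "at_frame f S a \<sigma> \<Longrightarrow> \<exists>m \<rho>. go \<sigma> m \<rho> \<and> m \<le> frame_cost f \<and> evaluated f S a \<sigma> \<rho>"
proof (induction f arbitrary: S a \<sigma> rule: less_induct)
  case (less f)
  note fr = less.prems
  have IH: "\<exists>m \<rho>. go \<tau> m \<rho> \<and> m \<le> frame_cost (f - 1) \<and> evaluated (f - 1) S' b \<tau> \<rho>"
    if "0 < f" "at_frame (f - 1) S' b \<tau>" for S' b \<tau>
    using less.IH[of "f - 1"] that by simp
  have Cn: "children f S a \<inter> {..<n} = children f S a" using card_children[OF fr] by auto
  obtain m \<tau> where m: "go \<sigma> m \<tau>" "m \<le> n + card (children f S a) * frame_cost (f - 1)"
    and sc: "scanned f S a \<sigma> n \<tau>"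
    using scan[OF fr IH order_refl] unfolding Cn by blast
  have k: "depth \<tau> = depth \<sigma>" "0 < depth \<sigma>" "posn \<tau> (depth \<tau>) = n" "vert \<tau> (depth \<tau>) = a"
    using sc fr by (auto simp: scanned_def at_frame_def)
  let ?\<tau> = "\<tau>\<lparr>posn := (posn \<tau>)(depth \<tau> := n + n),
    mark := (\<lambda>u. if u < n \<and> mark \<tau> u = depth \<tau> then 0 else mark \<tau> u)\<rparr>"
  have 1: "go \<tau> n ?\<tau>" by (rule unmark_scan) (use k in auto)
  have "step ?\<tau> = pop ?\<tau>" using k by (simp add: step_def)
  then have 2: "go ?\<tau> 1 (pop ?\<tau>)" using reaches_step[of active ?\<tau> step] k by (simp add: active_def)
  have g: "go \<sigma> (m + (n + 1)) (pop ?\<tau>)" using reaches_trans[OF m(1) reaches_trans[OF 1 2]] .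
  have cost: "m + (n + 1) \<le> frame_cost f"
  proof (cases f)
    case 0
    then show ?thesis using m(2) by (simp add: children_def frame_cost_def)
  next
    case (Suc f')
    have "m \<le> n + D * frame_cost f'"
      using m(2) mult_le_mono1[OF card_children(2)[OF fr], of "frame_cost f'"]
      unfolding Suc diff_Suc_1 by (rule order_trans[OF _ add_left_mono])
    then have "m + (n + 1) \<le> (2 * n + 1) * 1 + D * frame_cost f'" by simp
    also have "\<dots> \<le> D * frame_cost f' + D * frame_cost f'"
    proof -
      have "1 \<le> (2 * D) ^ f'" using D by (simp add: one_le_power)
      then have "(2 * n + 1) * 1 \<le> frame_cost f'" unfolding frame_cost_def by (rule mult_left_mono) simp
      also have "\<dots> \<le> D * frame_cost f'" using D by simp
      finally show ?thesis by simp
    qed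
    also have "\<dots> = frame_cost f" using Suc by (simp add: frame_cost_def algebra_simps)
    finally show ?thesis .
  qed
  have val: "tree_val E x f S a = x a * (\<Prod>w\<in>children f S a. 1 / (1 - tree_val E x (f - 1) (child_set E S a w) w))"
    by (cases f) (auto simp: children_def)
  have ok: "tree_ok E x f S a \<longleftrightarrow> tree_val E x f S a < 1 \<and>
      (\<forall>w\<in>children f S a. tree_ok E x (f - 1) (child_set E S a w) w)"
    by (cases f) (auto simp: children_def)
  have t: "x (vert ?\<tau> (depth ?\<tau>)) * prd ?\<tau> (depth ?\<tau>) = tree_val E x f S a"
    using sc k unfolding scanned_def val Cn by simp
  \<comment> \<open>Children were unmarked at entry, so clearing restores them; a mark
    \<open>depth \<sigma>\<close> present at entry, that of a root, is cleared as well.\<close>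
  have M: "mark (pop ?\<tau>) u = (if u < n \<and> mark \<sigma> u = depth \<sigma> then 0 else mark \<sigma> u)" for u
  proof (cases "u \<in> children f S a")
    case True
    then have "u < n" "mark \<sigma> u = 0" using card_children(3)[OF fr] child_iff[OF fr] by auto
    then show ?thesis using sc True k unfolding scanned_def by (simp add: pop_def Let_def)
  next
    case False
    then show ?thesis using sc k unfolding scanned_def by (simp add: pop_def Let_def)
  qed
  have "evaluated f S a \<sigma> (pop ?\<tau>)"
    unfolding evaluated_def ok
    using M sc k t unfolding scanned_def Cn
    by (auto simp: pop_def Let_def)
  then show ?case using g cost by blast
qed

text \<open>A completed root has cleared all marks, its own included, so every root starts from the
  full vertex set.\<close>

lemma all_roots:
  assumes "1 \<le> lim" "depth \<sigma> = 0" "root \<sigma> = 0" "\<And>u. mark \<sigma> u = 0" "\<not> bad \<sigma>" "r \<le> n"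
  shows "\<exists>m \<tau>. go \<sigma> m \<tau> \<and> m \<le> r * (1 + frame_cost (lim - 1)) \<and> depth \<tau> = 0 \<and> root \<tau> = r \<and>
    (\<forall>u. mark \<tau> u = 0) \<and> (bad \<tau> \<longleftrightarrow> (\<exists>v<r. \<not> tree_ok E x (lim - 1) {..<n} v))"
  using assms(6)
proof (induction r)
  case 0
  then show ?case using assms reaches_refl by (intro exI[of _ 0] exI[of _ \<sigma>]) auto
next
  case (Suc r)
  then obtain m \<tau> where m: "go \<sigma> m \<tau>" "m \<le> r * (1 + frame_cost (lim - 1))" and
    \<tau>: "depth \<tau> = 0" "root \<tau> = r" "\<And>u. mark \<tau> u = 0"
      "bad \<tau> \<longleftrightarrow> (\<exists>v<r. \<not> tree_ok E x (lim - 1) {..<n} v)" by auto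
  have "step \<tau> = start \<tau>" using \<tau> by (simp add: step_def)
  then have 1: "go \<tau> 1 (start \<tau>)" using reaches_step[of active \<tau> step] \<tau> Suc.prems by (simp add: active_def)
  have "at_frame (lim - 1) {..<n} r (start \<tau>)"
    using \<tau> Suc.prems assms(1) unfolding at_frame_def start_def by auto
  from evaluate[OF this] obtain m' \<rho> where 2: "go (start \<tau>) m' \<rho>" "m' \<le> frame_cost (lim - 1)"
    "evaluated (lim - 1) {..<n} r (start \<tau>) \<rho>" by blast
  have "go \<sigma> (m + (1 + m')) \<rho>" using reaches_trans[OF m(1) reaches_trans[OF 1 2(1)]] .
  moreover have "m + (1 + m') \<le> Suc r * (1 + frame_cost (lim - 1))" using m(2) 2(2) by simp
  moreover have "depth \<rho> = 0" "root \<rho> = Suc r" "\<forall>u. mark \<rho> u = 0"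
    "bad \<rho> \<longleftrightarrow> (\<exists>v<Suc r. \<not> tree_ok E x (lim - 1) {..<n} v)"
    using 2(3) \<tau> Suc.prems unfolding evaluated_def start_def by (auto simp: less_Suc_eq)
  ultimately show ?case by blast
qed

end

section \<open>The program\<close>

abbreviation cell :: "vname \<Rightarrow> nexp" where
  "cell a \<equiv> NGet a (NConst 0)"

abbreviation rcell :: "vname \<Rightarrow> rexp" where
  "rcell a \<equiv> RGet a (NConst 0)"

text \<open>
  Cells \<open>k\<close>, \<open>r\<close> hold \<open>depth\<close> and \<open>root\<close>; arrays \<open>v\<close>, \<open>w\<close>, \<open>m\<close>, \<open>c\<close> hold \<open>vert\<close>, \<open>posn\<close>, \<open>mark\<close>, \<open>prd\<close>.
  Array \<open>row\<close> holds the multiples of \<open>n\<close>, because indices cannot be multiplied, \<open>q\<close> approximates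
  \<open>1 / sqrt \<delta>\<close> from above, and \<open>y\<close> holds \<open>(1 - 1 / (3 q)) ^ (lim - 1)\<close>.
\<close>

definition top_cell :: "vname \<Rightarrow> nexp" where
  "top_cell a = NGet a (cell ''k'')"

definition value_exp :: rexp where
  "value_exp = RMul (RMul (RAdd (ROfNat (NConst 1)) (rcell ''alpha'')) (RGet ''p'' (top_cell ''v'')))
     (RGet ''c'' (cell ''k''))"

text \<open>Subtraction is truncated, so the sum is positive iff the stack is nonempty or a root is
  left.\<close>

definition active_exp :: bexp where
  "active_exp = NLess (NConst 0) (NAdd (cell ''k'') (NSub (cell ''n'') (cell ''r'')))"

definition start_com :: com where
  "start_com =
    Seq (NSet ''v'' (NConst 1) (cell ''r''))
    (Seq (NSet ''w'' (NConst 1) (NConst 0))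
    (Seq (NSet ''m'' (cell ''r'') (NConst 1))
    (Seq (RSet ''c'' (NConst 1) (ROfNat (NConst 1)))
    (Seq (NSet ''k'' (NConst 0) (NConst 1))
         (NSet ''r'' (NConst 0) (NAdd (cell ''r'') (NConst 1)))))))"

definition advance_com :: com where
  "advance_com = NSet ''w'' (cell ''k'') (NAdd (top_cell ''w'') (NConst 1))"

definition descends_exp :: bexp where
  "descends_exp = BAnd (NLess (cell ''k'') (cell ''lim''))
    (BAnd (NLess (NConst 0) (NGet ''adj'' (NAdd (NGet ''row'' (top_cell ''v'')) (top_cell ''w''))))
          (BNot (NLess (NConst 0) (NGet ''m'' (top_cell ''w'')))))"

text \<open>\<open>advance_com\<close> and the update of \<open>k\<close> come last, because the
  other assignments read the old position and depth.\<close>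

definition push_com :: com where
  "push_com =
    Seq (NSet ''m'' (top_cell ''w'') (cell ''k''))
    (Seq (NSet ''v'' (NAdd (cell ''k'') (NConst 1)) (top_cell ''w''))
    (Seq (NSet ''w'' (NAdd (cell ''k'') (NConst 1)) (NConst 0))
    (Seq (RSet ''c'' (NAdd (cell ''k'') (NConst 1)) (ROfNat (NConst 1)))
    (Seq advance_com
         (NSet ''k'' (NConst 0) (NAdd (cell ''k'') (NConst 1)))))))"

definition unmark_com :: com where
  "unmark_com = (let u = NSub (top_cell ''w'') (cell ''n''); mu = NGet ''m'' u in
    Cond (BAnd (BNot (NLess mu (cell ''k''))) (BNot (NLess (cell ''k'') mu)))
      (NSet ''m'' u (NConst 0)) Skip)"

definition pop_com :: com where
  "pop_com = (let k' = NSub (cell ''k'') (NConst 1) in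
    Seq (Cond (RLess value_exp (ROfNat (NConst 1))) Skip (NSet ''out'' (NConst 0) (NConst 0)))
    (Seq (RSet ''c'' k' (RDiv (RGet ''c'' k') (RSub (ROfNat (NConst 1)) value_exp)))
         (NSet ''k'' (NConst 0) k')))"

definition step_com :: com where
  "step_com =
    Cond (NLess (NConst 0) (cell ''k''))
      (Cond (NLess (top_cell ''w'') (cell ''n''))
        (Cond descends_exp push_com advance_com)
        (Cond (NLess (top_cell ''w'') (NAdd (cell ''n'') (cell ''n'')))
          (Seq unmark_com advance_com)
          pop_com))
      start_com"

definition search_com :: com where
  "search_com = While active_exp step_com"

text \<open>\<open>lim\<close> starts at 1 because a tree of depth \<open>level\<close> needs
  \<open>level + 1\<close> frames, counting that of the root.\<close>

definition init_com :: com where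
  "init_com = Seq (NSet ''out'' (NConst 0) (NConst 1))
    (Seq (NSet ''lim'' (NConst 0) (NConst 1)) (RSet ''y'' (NConst 0) (ROfNat (NConst 1))))"

definition rows_com :: com where
  "rows_com = While (NLess (cell ''i'') (cell ''n''))
    (Seq (NSet ''row'' (NAdd (cell ''i'') (NConst 1)) (NAdd (NGet ''row'' (cell ''i'')) (cell ''n'')))
         (NSet ''i'' (NConst 0) (NAdd (cell ''i'') (NConst 1))))"

text \<open>Finds the least \<open>q\<close> with
  \<open>1 / q\<^sup>2 \<le> \<alpha> / (8 * n)\<close> without a square root; \<open>1 / q\<close>
  serves as \<open>K\<close>.\<close>

definition scale_com :: com where
  "scale_com = While
    (RLess (RMul (RMul (ROfNat (cell ''q'')) (ROfNat (cell ''q''))) (rcell ''alpha''))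
       (RMul (ROfNat (NConst 8)) (ROfNat (cell ''n''))))
    (NSet ''q'' (NConst 0) (NAdd (cell ''q'') (NConst 1)))"

text \<open>Finds the least depth satisfying the condition on \<open>l\<close> in
  \<open>exists_failing_tree\<close>, without a logarithm.\<close>

definition level_com :: com where
  "level_com = While
    (RLess (RMul (rcell ''alpha'') (rcell ''alpha''))
       (RMul (RMul (ROfNat (NConst 32)) (ROfNat (cell ''n''))) (rcell ''y'')))
    (Seq (RSet ''y'' (NConst 0) (RMul (rcell ''y'') (RSub (ROfNat (NConst 1))
            (RDiv (RDiv (ROfNat (NConst 1)) (ROfNat (cell ''q''))) (ROfNat (NConst 3))))))
         (NSet ''lim'' (NConst 0) (NAdd (cell ''lim'') (NConst 1))))"

definition program :: com where
  "program = Seq init_com (Seq rows_com (Seq scale_com (Seq level_com search_com)))"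

section \<open>Simulation of the search by the program\<close>

locale instance_data =
  fixes n :: nat and E :: "nat set set" and p :: "nat \<Rightarrow> real" and \<alpha> :: real
  assumes n: "1 \<le> n" and graph: "simple_graph {..<n} E" and p: "\<And>v. v < n \<Longrightarrow> 0 < p v \<and> p v < 1"
    and \<alpha>: "0 < \<alpha>" "\<alpha> \<le> 1"
begin

definition holds_input :: "state \<Rightarrow> bool" where
  "holds_input s \<longleftrightarrow> narr s ''n'' 0 = n \<and> rarr s ''alpha'' 0 = \<alpha> \<and> (\<forall>v<n. rarr s ''p'' v = p v) \<and>
    (\<forall>a<n. \<forall>b<n. 0 < narr s ''adj'' (a * n + b) \<longleftrightarrow> {a, b} \<in> E)"

definition fresh :: "state \<Rightarrow> bool" where
  "fresh s \<longleftrightarrow> holds_input s \<and> narr s ''k'' 0 = 0 \<and> narr s ''r'' 0 = 0 \<and> (\<forall>u. narr s ''m'' u = 0) \<and>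
    narr s ''out'' 0 = 1"

lemma fresh_input: "fresh (exec init_com (input_state n E p \<alpha>))"
proof -
  have "(a * n + b) div n = a \<and> (a * n + b) mod n = b \<and> a * n + b < n * n" if "a < n" "b < n" for a b
  proof -
    have "a * n + b < (a + 1) * n" using that by simp
    also have "\<dots> \<le> n * n" using that by (intro mult_right_mono) auto
    finally show ?thesis using that by simp
  qed
  then show ?thesis
    by (simp add: fresh_def holds_input_def init_com_def input_state_def nupd_def rupd_def)
qed

text \<open>Whole arrays are identified, including cells above the stack. The bound on the vertices
  of the stack keeps reads of \<open>p\<close> and \<open>row\<close> in the range where these
  arrays are specified.\<close>

definition searching :: "nat \<Rightarrow> state \<Rightarrow> config \<Rightarrow> bool" where
  "searching L s \<sigma> \<longleftrightarrow> holds_input s \<and> (\<forall>a<n. narr s ''row'' a = a * n) \<and> narr s ''lim'' 0 = L \<and>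
    narr s ''k'' 0 = depth \<sigma> \<and> narr s ''r'' 0 = root \<sigma> \<and> narr s ''v'' = vert \<sigma> \<and>
    narr s ''w'' = posn \<sigma> \<and> narr s ''m'' = mark \<sigma> \<and> rarr s ''c'' = prd \<sigma> \<and>
    narr s ''out'' 0 = (if bad \<sigma> then 0 else 1) \<and> (\<forall>i\<in>{1..depth \<sigma>}. vert \<sigma> i < n)"

end

text \<open>\<open>L\<close> stays free because the stack bound is computed by the program. The
  maximum with 2 ensures \<open>1 \<le> D\<close> and matches \<open>time_bound\<close>. Neighbours
  \<open>b\<close> of \<open>a\<close> inject into the edges at \<open>a\<close> by
  \<open>{a, b}\<close>.\<close>

sublocale instance_data \<subseteq> search n E "\<lambda>v. (1 + \<alpha>) * p v" L "max 2 (max_degree {..<n} E)" for L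
proof
  have card2: "card e = 2" if "e \<in> E" for e using graph that by (simp add: simple_graph_def)
  show no_loop: "{a} \<notin> E" for a using card2[of "{a}"] by auto
  show "card ({..<n} \<inter> nbrs E a) \<le> max 2 (max_degree {..<n} E)" if "a < n" for a
  proof -
    have "finite {e \<in> E. a \<in> e}"
      by (rule finite_subset[of _ "Pow {..<n}"]) (use graph in \<open>auto simp: simple_graph_def\<close>)
    moreover have "(\<lambda>b. {a, b}) ` ({..<n} \<inter> nbrs E a) \<subseteq> {e \<in> E. a \<in> e}" by (auto simp: nbrs_def)
    moreover have "inj_on (\<lambda>b. {a, b}) ({..<n} \<inter> nbrs E a)"
      by (rule inj_onI) (auto simp: doubleton_eq_iff)
    ultimately have "card ({..<n} \<inter> nbrs E a) \<le> vertex_degree E a"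
      unfolding vertex_degree_def by (intro card_inj_on_le[of "\<lambda>b. {a, b}"])
    also have "\<dots> \<le> max_degree {..<n} E" unfolding max_degree_def using that by (intro Max_ge) auto
    finally show ?thesis by simp
  qed
qed simp

context instance_data
begin

lemma searching_active: "searching L s \<sigma> \<Longrightarrow> bval s active_exp \<longleftrightarrow> active \<sigma>"
  by (auto simp: searching_def holds_input_def active_exp_def active_def)

lemma searching_start:
  "searching L s \<sigma> \<Longrightarrow> active \<sigma> \<Longrightarrow> depth \<sigma> = 0 \<Longrightarrow> searching L (exec start_com s) (start \<sigma>)"
  by (auto simp: searching_def holds_input_def active_def start_com_def start_def nupd_def rupd_def)

lemma searching_advance:
  "searching L s \<sigma> \<Longrightarrow> searching L (exec advance_com s) (advance \<sigma>)"
  by (auto simp: searching_def holds_input_def advance_com_def advance_def nupd_def top_cell_def)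

lemma searching_descends:
  "searching L s \<sigma> \<Longrightarrow> 0 < depth \<sigma> \<Longrightarrow> posn \<sigma> (depth \<sigma>) < n \<Longrightarrow> bval s descends_exp \<longleftrightarrow> descends L \<sigma>"
  by (auto simp: searching_def holds_input_def descends_exp_def descends_def top_cell_def)

lemma searching_push:
  "searching L s \<sigma> \<Longrightarrow> posn \<sigma> (depth \<sigma>) < n \<Longrightarrow> searching L (exec push_com s) (push \<sigma>)"
  by (auto simp: searching_def holds_input_def push_com_def advance_com_def push_def Let_def nupd_def
      rupd_def top_cell_def fun_eq_iff le_Suc_eq)

lemma searching_unmark:
  "searching L s \<sigma> \<Longrightarrow> searching L (exec unmark_com s) (unmark \<sigma>)"
  by (auto simp: searching_def holds_input_def unmark_com_def unmark_def Let_def nupd_def top_cell_def)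

lemma searching_pop:
  "searching L s \<sigma> \<Longrightarrow> 0 < depth \<sigma> \<Longrightarrow> searching L (exec pop_com s) (pop \<sigma>)"
  by (auto simp: searching_def holds_input_def pop_com_def value_exp_def pop_def Let_def nupd_def
      rupd_def top_cell_def)

lemma searching_step:
  assumes "searching L s \<sigma>" "active \<sigma>"
  shows "searching L (exec step_com s) (step L \<sigma>)"
proof -
  have v: "nval s (cell ''k'') = depth \<sigma>" "nval s (top_cell ''w'') = posn \<sigma> (depth \<sigma>)" "nval s (cell ''n'') = n"
    using assms by (auto simp: searching_def holds_input_def top_cell_def)
  show ?thesis
    using assms searching_start[of L s \<sigma>] searching_advance[of L s \<sigma>] searching_descends[of L s \<sigma>]
      searching_push[of L s \<sigma>] searching_advance[OF searching_unmark[of L s \<sigma>]] searching_pop[of L s \<sigma>]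
    unfolding step_com_def step_def by (simp add: v del: nval.simps(2) add: nval.simps(1,3))
qed

end

section \<open>Sizes of the scale and of the depth\<close>

lemma nat_ceiling_le:
  fixes y :: real
  assumes "0 \<le> y"
  shows "real (nat \<lceil>y\<rceil>) \<le> y + 1"
  using assms by linarith

context instance_data
begin

definition rows_ready :: "state \<Rightarrow> bool" where
  "rows_ready s \<longleftrightarrow> fresh s \<and> (\<forall>a<n. narr s ''row'' a = a * n)"

definition below_scale :: "nat \<Rightarrow> bool" where
  "below_scale q \<longleftrightarrow> real q * real q * \<alpha> < 8 * real n"

definition scale :: nat where
  "scale = (LEAST q. \<not> below_scale q)"

definition below_level :: "nat \<Rightarrow> bool" where
  "below_level l \<longleftrightarrow> \<alpha> * \<alpha> < 32 * real n * (1 - 1 / real scale / 3) ^ l"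

definition level :: nat where
  "level = (LEAST l. \<not> below_level l)"

abbreviation "scale_bound \<equiv> sqrt (real n / \<alpha>)"
abbreviation "power_base \<equiv> max 2 (real n / \<alpha>)"

lemma scale_bound_ge_1: "1 \<le> real n / \<alpha>" "1 \<le> scale_bound"
proof -
  have "\<alpha> \<le> real n" using n \<alpha> by linarith
  then show "1 \<le> real n / \<alpha>" using \<alpha> by simp
  then show "1 \<le> scale_bound" by simp
qed

lemma scale: "\<not> below_scale scale" "real scale \<le> 4 * scale_bound" "1 \<le> scale"
proof -
  \<comment> \<open>The constant 3 suffices because \<open>3 * 3 \<ge> 8\<close>.\<close>
  let ?m = "nat \<lceil>3 * scale_bound\<rceil>"
  have m: "3 * scale_bound \<le> real ?m" by (simp add: real_nat_ceiling_ge)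
  have "9 * real n = 3 * scale_bound * (3 * scale_bound) * \<alpha>" using \<alpha> by simp
  also have "\<dots> \<le> real ?m * real ?m * \<alpha>"
  proof -
    have "0 \<le> 3 * scale_bound" using scale_bound_ge_1 by linarith
    then have "3 * scale_bound * (3 * scale_bound) \<le> real ?m * real ?m"
      by (intro mult_mono[OF m m]) (rule of_nat_0_le_iff)
    then show ?thesis using \<alpha> by (intro mult_right_mono) linarith+
  qed
  finally have *: "\<not> below_scale ?m" using n by (simp add: below_scale_def)
  show nb: "\<not> below_scale scale" unfolding scale_def by (rule LeastI[of "\<lambda>q. \<not> below_scale q", OF *])
  have "scale \<le> ?m" unfolding scale_def by (rule Least_le[of "\<lambda>q. \<not> below_scale q", OF *])
  moreover have "real ?m \<le> 3 * scale_bound + 1"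
    using scale_bound_ge_1 by (intro nat_ceiling_le) linarith
  ultimately show "real scale \<le> 4 * scale_bound" using scale_bound_ge_1 by linarith
  show "1 \<le> scale" using nb n by (cases scale) (auto simp: below_scale_def)
qed

lemma level: "\<not> below_level level" "real level \<le> 84 * scale_bound * ln power_base + 1"
proof -
  let ?K = "1 / real scale"
  \<comment> \<open>As \<open>21 / 3 = 7\<close>, the decay is at most
    \<open>1 / power_base ^ 7\<close>: five of these factors absorb \<open>32 = 2 ^ 5\<close>, the
    other two absorb \<open>n / \<alpha>\<^sup>2 \<le> (n / \<alpha>)\<^sup>2\<close>.\<close>
  let ?m = "nat \<lceil>21 * real scale * ln power_base\<rceil>"
  have K: "0 < ?K" "?K \<le> 1" using scale(3) by auto
  have X: "2 \<le> power_base" by simp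
  have lX: "0 \<le> ln power_base" by simp
  have m: "21 * real scale * ln power_base \<le> real ?m" by (simp add: real_nat_ceiling_ge)
  have "(1 - ?K / 3) ^ ?m \<le> exp (- ?K / 3) ^ ?m"
    using K exp_ge_add_one_self[of "- ?K / 3"] by (intro power_mono) auto
  also have "\<dots> = exp (- (?K / 3 * real ?m))" by (simp add: exp_of_nat_mult[symmetric] mult_ac)
  also have "\<dots> \<le> exp (- (?K / 3 * (21 * real scale * ln power_base)))"
    using m K by (intro exp_mono le_imp_neg_le mult_left_mono) auto
  also have "?K / 3 * (21 * real scale * ln power_base) = real 7 * ln power_base" using K by simp
  also have "exp (- (real 7 * ln power_base)) = 1 / power_base ^ 7"
    unfolding exp_minus exp_of_nat_mult by (simp add: inverse_eq_divide)
  finally have 1: "(1 - ?K / 3) ^ ?m \<le> 1 / power_base ^ 7" .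
  have "32 * real n * (1 / power_base ^ 7) \<le> \<alpha> * \<alpha>"
  proof -
    have "real n * 1 \<le> real n * real n" using n by (intro mult_left_mono) auto
    then have "32 * real n / (\<alpha> * \<alpha>) \<le> 2 ^ 5 * (real n / \<alpha>)\<^sup>2"
      using \<alpha> by (simp add: power2_eq_square field_simps)
    also have "\<dots> \<le> power_base ^ 5 * power_base\<^sup>2"
      using scale_bound_ge_1 by (intro mult_mono power_mono) auto
    also have "\<dots> = power_base ^ 7" by (simp flip: power_add)
    finally have "32 * real n \<le> power_base ^ 7 * (\<alpha> * \<alpha>)" using \<alpha> by (simp add: pos_divide_le_eq)
    moreover have "0 < power_base ^ 7" by (simp add: less_max_iff_disj)
    ultimately show ?thesis by (simp add: pos_divide_le_eq mult.commute)
  qed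
  moreover have "32 * real n * (1 - ?K / 3) ^ ?m \<le> 32 * real n * (1 / power_base ^ 7)"
    by (rule mult_left_mono[OF 1]) simp
  ultimately have *: "\<not> below_level ?m" unfolding below_level_def by linarith
  show "\<not> below_level level" unfolding level_def by (rule LeastI[of "\<lambda>q. \<not> below_level q", OF *])
  have "level \<le> ?m" unfolding level_def by (rule Least_le[of "\<lambda>q. \<not> below_level q", OF *])
  moreover have "real ?m \<le> 21 * real scale * ln power_base + 1"
    by (intro nat_ceiling_le mult_nonneg_nonneg lX) auto
  moreover have "21 * real scale * ln power_base \<le> 21 * (4 * scale_bound) * ln power_base"
    using scale(2) lX by (intro mult_right_mono mult_left_mono) auto
  ultimately show "real level \<le> 84 * scale_bound * ln power_base + 1" by linarith
qed

section \<open>Execution of the four loops\<close>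

lemma below_Least: "i < (LEAST j. \<not> g j) \<Longrightarrow> g (i::nat)"
  using not_less_Least by blast

definition all_trees_ok :: bool where
  "all_trees_ok \<longleftrightarrow> (\<forall>v<n. tree_ok E (\<lambda>v. (1 + \<alpha>) * p v) level {..<n} v)"

definition work :: nat where
  "work = (n + 1) + (scale + 1) + (level + 1) + (n * (1 + frame_cost level) + 1)"

lemma run_rows:
  assumes "fresh s" "narr s ''i'' 0 = 0" "narr s ''row'' 0 = 0" "narr s ''q'' 0 = 0"
    "narr s ''lim'' 0 = 1" "rarr s ''y'' 0 = 1"
  obtains t s' where "runs rows_com s t s'" "t \<le> (n + 1) * iter_cost rows_com" "rows_ready s'"
    "narr s' ''q'' 0 = 0" "narr s' ''lim'' 0 = 1" "rarr s' ''y'' 0 = 1"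
proof -
  define R where "R s i \<longleftrightarrow> fresh s \<and> narr s ''i'' 0 = i \<and> (\<forall>j\<le>i. narr s ''row'' j = j * n) \<and>
    narr s ''q'' 0 = 0 \<and> narr s ''lim'' 0 = 1 \<and> rarr s ''y'' 0 = 1" for s i
  have "\<exists>t s'. runs rows_com s t s' \<and> R s' n \<and> t \<le> (n + 1) * iter_cost rows_com"
    unfolding rows_com_def
  proof (rule runs_While[where g = "\<lambda>i. i < n" and f = Suc and \<sigma> = 0])
    show "R s 0" using assms by (simp add: R_def)
    show "reaches (\<lambda>i. i < n) Suc 0 n n" by (rule reaches_Suc)
  qed (auto simp: R_def fresh_def holds_input_def nupd_def le_Suc_eq)
  then show ?thesis using that by (auto simp: R_def rows_ready_def)
qed

lemma run_scale:
  assumes "rows_ready s" "narr s ''q'' 0 = 0" "narr s ''lim'' 0 = 1" "rarr s ''y'' 0 = 1"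
  obtains t s' where "runs scale_com s t s'" "t \<le> (scale + 1) * iter_cost scale_com" "rows_ready s'"
    "narr s' ''q'' 0 = scale" "narr s' ''lim'' 0 = 1" "rarr s' ''y'' 0 = 1"
proof -
  define R where "R s q \<longleftrightarrow> rows_ready s \<and> narr s ''q'' 0 = q \<and> narr s ''lim'' 0 = 1 \<and>
    rarr s ''y'' 0 = 1" for s q
  have "\<exists>t s'. runs scale_com s t s' \<and> R s' scale \<and> t \<le> (scale + 1) * iter_cost scale_com"
    unfolding scale_com_def
  proof (rule runs_While[where g = below_scale and f = Suc and \<sigma> = 0])
    show "R s 0" using assms by (simp add: R_def)
    show "reaches below_scale Suc 0 scale scale"
      by (intro reaches_Suc below_Least[where g = below_scale]) (simp only: scale_def)
    show "\<not> below_scale scale" by (rule scale)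
  qed (auto simp: R_def rows_ready_def fresh_def holds_input_def nupd_def below_scale_def)
  then show ?thesis using that by (auto simp: R_def)
qed

lemma run_level:
  assumes "rows_ready s" "narr s ''q'' 0 = scale" "narr s ''lim'' 0 = 1" "rarr s ''y'' 0 = 1"
  obtains t s' where "runs level_com s t s'" "t \<le> (level + 1) * iter_cost level_com" "rows_ready s'"
    "narr s' ''lim'' 0 = level + 1"
proof -
  define R where "R s l \<longleftrightarrow> rows_ready s \<and> narr s ''q'' 0 = scale \<and> narr s ''lim'' 0 = l + 1 \<and>
    rarr s ''y'' 0 = (1 - 1 / real scale / 3) ^ l" for s l
  have "\<exists>t s'. runs level_com s t s' \<and> R s' level \<and> t \<le> (level + 1) * iter_cost level_com"
    unfolding level_com_def
  proof (rule runs_While[where g = below_level and f = Suc and \<sigma> = 0])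
    show "R s 0" using assms by (simp add: R_def)
    show "reaches below_level Suc 0 level level"
      by (intro reaches_Suc below_Least[where g = below_level]) (simp only: level_def)
    show "\<not> below_level level" by (rule level)
  qed (auto simp: R_def rows_ready_def fresh_def holds_input_def nupd_def rupd_def below_level_def)
  then show ?thesis using that by (auto simp: R_def)
qed

lemma run_search:
  assumes "rows_ready s" "narr s ''lim'' 0 = level + 1"
  obtains t s' where "runs search_com s t s'" "accepts s' \<longleftrightarrow> all_trees_ok"
    "t \<le> (n * (1 + frame_cost level) + 1) * iter_cost search_com"
proof -
  let ?L = "level + 1"
  define \<sigma> where "\<sigma> = \<lparr>depth = 0, root = 0, vert = narr s ''v'', posn = narr s ''w'',
    mark = narr s ''m'', prd = rarr s ''c'', bad = False\<rparr>"
  have R: "searching ?L s \<sigma>"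
    using assms by (simp add: searching_def rows_ready_def fresh_def \<sigma>_def)
  have "\<And>u. mark \<sigma> u = 0" using assms by (simp add: rows_ready_def fresh_def \<sigma>_def)
  then obtain m \<tau> where m: "reaches active (step ?L) \<sigma> m \<tau>" "m \<le> n * (1 + frame_cost level)"
    "depth \<tau> = 0" "root \<tau> = n" "bad \<tau> \<longleftrightarrow> \<not> all_trees_ok"
    using all_roots[of ?L \<sigma> n] unfolding all_trees_ok_def by (auto simp: \<sigma>_def)
  have "\<exists>t s'. runs search_com s t s' \<and> searching ?L s' \<tau> \<and> t \<le> (m + 1) * iter_cost search_com"
    unfolding search_com_def
  proof (rule runs_While[where g = active and f = "step ?L" and \<sigma> = \<sigma>])
    show "loop_free step_com"
      by (simp add: step_com_def descends_exp_def push_com_def advance_com_def unmark_com_def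
          pop_com_def start_com_def Let_def)
    show "searching ?L s \<sigma>" by (rule R)
    show "reaches active (step ?L) \<sigma> m \<tau>" by (rule m(1))
    show "\<not> active \<tau>" using m by (simp add: active_def)
  qed (auto simp: searching_active searching_step)
  then obtain t s' where t: "runs search_com s t s'" "searching ?L s' \<tau>" "t \<le> (m + 1) * iter_cost search_com"
    by blast
  have "t \<le> (n * (1 + frame_cost level) + 1) * iter_cost search_com"
    using t(3) m(2) by (meson add_le_mono1 mult_le_mono1 order_trans)
  moreover have "accepts s' \<longleftrightarrow> all_trees_ok" using t(2) m(5) by (simp add: searching_def accepts_def)
  ultimately show ?thesis using that t(1) by blast
qed

end

text \<open>Kept outside the locale: it depends on the program text alone, so the final constant is
  the same for all instances.\<close>

definition unit_cost :: nat where
  "unit_cost = cost_bound init_com + iter_cost rows_com + iter_cost scale_com + iter_cost level_com +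
     iter_cost search_com"

context instance_data
begin

lemma run_program:
  obtains t s where "runs program (input_state n E p \<alpha>) t s" "t \<le> unit_cost * work" "accepts s \<longleftrightarrow> all_trees_ok"
proof -
  let ?s0 = "exec init_com (input_state n E p \<alpha>)"
  have "loop_free init_com" by (simp add: init_com_def)
  then obtain t0 where 0: "runs init_com (input_state n E p \<alpha>) t0 ?s0" "t0 \<le> cost_bound init_com"
    using runs_loop_free by blast
  obtain t1 s1 where 1: "runs rows_com ?s0 t1 s1" "t1 \<le> (n + 1) * iter_cost rows_com" "rows_ready s1"
    "narr s1 ''q'' 0 = 0" "narr s1 ''lim'' 0 = 1" "rarr s1 ''y'' 0 = 1"
    by (rule run_rows[OF fresh_input]) (simp_all add: init_com_def input_state_def nupd_def rupd_def)
  obtain t2 s2 where 2: "runs scale_com s1 t2 s2" "t2 \<le> (scale + 1) * iter_cost scale_com" "rows_ready s2"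
    "narr s2 ''q'' 0 = scale" "narr s2 ''lim'' 0 = 1" "rarr s2 ''y'' 0 = 1"
    using run_scale[OF 1(3-6)] by blast
  obtain t3 s3 where 3: "runs level_com s2 t3 s3" "t3 \<le> (level + 1) * iter_cost level_com" "rows_ready s3"
    "narr s3 ''lim'' 0 = level + 1"
    using run_level[OF 2(3-6)] by blast
  obtain t4 s4 where 4: "runs search_com s3 t4 s4" "accepts s4 \<longleftrightarrow> all_trees_ok"
    "t4 \<le> (n * (1 + frame_cost level) + 1) * iter_cost search_com"
    using run_search[OF 3(3-4)] by blast
  have "runs program (input_state n E p \<alpha>) (t0 + (t1 + (t2 + (t3 + t4)))) s4"
    unfolding program_def
    by (rule runs.Seq[OF 0(1) runs.Seq[OF 1(1) runs.Seq[OF 2(1) runs.Seq[OF 3(1) 4(1)]]]])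
  moreover have "t0 + (t1 + (t2 + (t3 + t4))) \<le> unit_cost * work"
  proof -
    have le: "a \<le> k * i \<Longrightarrow> k \<le> work \<Longrightarrow> a \<le> work * i" for a k i
      by (meson mult_le_mono1 order_trans)
    have "t0 \<le> work * cost_bound init_com" by (rule le[of _ 1]) (use 0(2) in \<open>auto simp: work_def\<close>)
    moreover have "t1 \<le> work * iter_cost rows_com" by (rule le[OF 1(2)]) (simp add: work_def)
    moreover have "t2 \<le> work * iter_cost scale_com" by (rule le[OF 2(2)]) (simp add: work_def)
    moreover have "t3 \<le> work * iter_cost level_com" by (rule le[OF 3(2)]) (simp add: work_def)
    moreover have "t4 \<le> work * iter_cost search_com" by (rule le[OF 4(3)]) (simp add: work_def)
    ultimately have "t0 + (t1 + (t2 + (t3 + t4))) \<le> work * cost_bound init_com + (work * iter_cost rows_com +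
        (work * iter_cost scale_com + (work * iter_cost level_com + work * iter_cost search_com)))"
      by (intro add_mono)
    then show ?thesis by (simp add: unit_cost_def algebra_simps)
  qed
  ultimately show ?thesis using that 4(2) by blast
qed

section \<open>Correctness of the decision\<close>

lemma decision:
  "if all_trees_ok then p \<in> shearer_region {..<n} E else (\<lambda>v. (1 + \<alpha>) * p v) \<notin> shearer_region {..<n} E"
proof -
  interpret ordered_graph E "{..<n}" by unfold_locales (use no_loop in auto)
  show ?thesis
  proof (cases all_trees_ok)
    case True
    have "q_pos E {..<n} p"
    proof (rule ccontr)
      assume npos: "\<not> ?thesis"
      let ?K = "1 / real scale"
      \<comment> \<open>Outside the region some tree of the computed depth fails, contrary to
        acceptance.\<close>
      have "\<exists>v\<in>{..<n}. \<not> tree_ok E (\<lambda>v. (1 + \<alpha>) * p v) level {..<n} v"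
      proof (rule exists_failing_tree[OF _ npos \<alpha>])
        show "0 < ?K" using scale by simp
        have "real scale * real scale * \<alpha> \<ge> 8 * real n" using scale by (simp add: below_scale_def)
        then show "?K\<^sup>2 \<le> \<alpha> / (8 * real (card {..<n}))"
          using scale n by (simp add: power2_eq_square field_simps)
        show "(1 - ?K / 3) ^ level * (32 * real (card {..<n})) \<le> \<alpha>\<^sup>2"
          using level by (simp add: below_level_def power2_eq_square mult_ac)
      qed (use p in auto)
      then show False using True by (auto simp: all_trees_ok_def)
    qed
    then have "p \<in> shearer_region {..<n} E"
      using shearer_region_iff[of p] p by (auto intro: less_imp_le)
    then show ?thesis using True by simp
  next
    case False
    then obtain v where v: "v < n" "\<not> tree_ok E (\<lambda>v. (1 + \<alpha>) * p v) level {..<n} v" by (auto simp: all_trees_ok_def)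
    have "(\<lambda>v. (1 + \<alpha>) * p v) \<notin> shearer_region {..<n} E"
    proof
      assume r: "(\<lambda>v. (1 + \<alpha>) * p v) \<in> shearer_region {..<n} E"
      \<comment> \<open>Membership itself supplies the bounds 0 and 1 that
        \<open>shearer_region_iff\<close> presupposes.\<close>
      then have "q_pos E {..<n} (\<lambda>v. (1 + \<alpha>) * p v)"
        using shearer_region_iff[of "\<lambda>v. (1 + \<alpha>) * p v"] by (auto simp: shearer_region_def)
      then show False
        using tree_val_le_ratio[of "\<lambda>v. (1 + \<alpha>) * p v" "{..<n}" v level] v p \<alpha> by auto
    qed
    then show ?thesis using False by simp
  qed
qed

section \<open>The running time\<close>

lemma work_bound:
  fixes c :: nat
  assumes c: "1 \<le> c"
  shows "real (c * work) \<le> time_bound (4 * ln (15 * c) + 176) n (max_degree {..<n} E) \<alpha>"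
proof -
  define X where "X = power_base"
  define s where "s = scale_bound"
  define D where "D = max 2 (max_degree {..<n} E)"
  define Y where "Y = (2 * real D) ^ level"
  have X: "2 \<le> X" "real n / \<alpha> \<le> X" by (auto simp: X_def)
  have s1: "1 \<le> s" using scale_bound_ge_1 by (simp add: s_def)
  have D2: "2 \<le> D" by (simp add: D_def)
  have "real n * \<alpha> \<le> real n" using \<alpha> by (simp add: mult_left_le)
  then have "real n \<le> real n / \<alpha>" using \<alpha> by (simp add: pos_le_divide_eq)
  then have nX: "real n \<le> X" using X by linarith
  have "s\<^sup>2 = real n / \<alpha>" using scale_bound_ge_1 by (simp add: s_def)
  moreover have "s \<le> s\<^sup>2" using s1 by (simp add: power2_eq_square)
  ultimately have sX: "s \<le> X" using X by linarith
  have lY: "real level \<le> Y"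
  proof -
    have "real level \<le> 2 ^ level" using of_nat_less_two_power[of level] by (simp add: less_imp_le)
    also have "\<dots> \<le> Y" unfolding Y_def using D2 by (intro power_mono) auto
    finally show ?thesis .
  qed
  have Y1: "1 \<le> Y" unfolding Y_def using D2 by (intro one_le_power) auto
  have q: "real scale \<le> 4 * X" using scale(2) sX by (simp add: s_def)
  have X1: "1 \<le> X * X" "X \<le> X * X" "0 \<le> X" using X by (auto intro: mult_ge1_I)
  have XY: "X * X \<le> X * X * Y" "Y \<le> X * X * Y" 
    using mult_left_mono[OF Y1, of "X * X"] mult_right_mono[OF X1(1), of Y] X1 Y1 by auto
  have "real work = real n + real scale + real level + real n + (2 * real n + 1) * Y * real n + 4"
    by (simp add: work_def frame_cost_def Y_def D_def algebra_simps)
  also have "(2 * real n + 1) * Y * real n \<le> (2 * X + X) * Y * X"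
    using nX X Y1 by (intro mult_mono) auto
  also have "(2 * X + X) * Y * X = 3 * (X * X * Y)" by simp
  \<comment> \<open>The vertex terms, \<open>scale\<close>, \<open>level\<close>, the constant 4 and
    the search contribute at most 2, 4, 1, 4 and 3 times \<open>X * X * Y\<close>.\<close>
  finally have W: "real work \<le> 15 * (X * X * Y)" using nX q lY X1 XY by linarith
  \<comment> \<open>With both logarithms bounded below, all lower-order terms can be charged to
    \<open>?U\<close>, the logarithm of the time bound up to its constant.\<close>
  have lX: "1 / 2 \<le> ln X" and lD: "1 / 2 \<le> ln (real D)"
  proof -
    have "ln (1 / 2 :: real) \<le> 1 / 2 - 1" by (rule ln_le_minus_one) simp
    then have l2: "1 / 2 \<le> ln (2 :: real)" by (simp add: ln_div)
    have "ln 2 \<le> ln X" "ln 2 \<le> ln (real D)" using X D2 by (auto intro!: ln_mono)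
    then show "1 / 2 \<le> ln X" "1 / 2 \<le> ln (real D)" using l2 by linarith+
  qed
  let ?U = "s * ln (real D) * ln X"
  have "1 / 2 * ln X \<le> ln (real D) * ln X" using lX lD by (intro mult_right_mono) auto
  moreover have "1 * (ln (real D) * ln X) \<le> s * (ln (real D) * ln X)"
    using s1 lX lD by (intro mult_right_mono) auto
  ultimately have U1: "ln X \<le> 2 * ?U" by (simp add: mult.assoc)
  then have U2: "1 \<le> 4 * ?U" using lX by linarith
  have c15: "0 \<le> ln (15 * real c)" using c by simp
  have "ln 2 \<le> ln (real D)" using D2 by (auto intro!: ln_mono)
  then have "ln (2 * real D) \<le> 2 * ln (real D)" using D2 by (simp add: ln_mult)
  then have "real level * ln (2 * real D) \<le> (84 * s * ln X + 1) * (2 * ln (real D))"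
    using level(2) lD D2 s1 lX by (intro mult_mono) (auto simp: s_def X_def)
  also have "\<dots> = 168 * ?U + 2 * ln (real D)" by (simp add: algebra_simps)
  also have "2 * ln (real D) \<le> 4 * ?U"
  proof -
    have "1 / 2 \<le> s * ln X" using mult_mono[of 1 s "1 / 2" "ln X"] s1 lX by simp
    then have "ln (real D) * (1 / 2) \<le> ln (real D) * (s * ln X)" using lD by (intro mult_left_mono) auto
    then show ?thesis by (simp add: mult_ac)
  qed
  finally have "real level * ln (2 * real D) \<le> 172 * ?U" by linarith
  moreover have "ln Y = real level * ln (2 * real D)"
    unfolding Y_def by (rule ln_realpow)
  ultimately have L: "ln Y \<le> 172 * ?U" by simp
  have "1 * ln (15 * real c) \<le> 4 * ?U * ln (15 * real c)" using U2 c15 by (intro mult_right_mono) auto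
  \<comment> \<open>The constant 176 is \<open>2 + 2\<close> for the two copies of
    \<open>ln X\<close> plus 172 for \<open>ln Y\<close>.\<close>
  then have "ln (15 * real c) + (ln X + ln X + ln Y) \<le> (4 * ln (15 * c) + 176) * ?U"
    using U1 L by (simp add: algebra_simps)
  also have "\<dots> = (4 * ln (15 * c) + 176) * s * ln (real D) * ln X" by simp
  finally have "exp (ln (15 * real c) + (ln X + ln X + ln Y)) \<le>
      X powr ((4 * ln (15 * c) + 176) * s * ln (real D))"
    using X by (simp add: powr_def)
  moreover have "exp (ln (15 * real c) + (ln X + ln X + ln Y)) = 15 * real c * (X * X * Y)"
    unfolding exp_add using X Y1 c by simp
  moreover have "real (c * work) \<le> 15 * real c * (X * X * Y)"
    using mult_left_mono[OF W, of "real c"] by simp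
  moreover have "real D = max 2 (real (max_degree {..<n} E))" by (simp add: D_def of_nat_max)
  ultimately show ?thesis unfolding time_bound_def X_def s_def by simp
qed

lemma program_correct:
  "\<exists>t s. runs program (input_state n E p \<alpha>) t s \<and>
     real t \<le> time_bound (4 * ln (15 * real unit_cost) + 176) n (max_degree {..<n} E) \<alpha> \<and>
     (if accepts s then p \<in> shearer_region {..<n} E
      else (\<lambda>v. (1 + \<alpha>) * p v) \<notin> shearer_region {..<n} E)"
proof -
  obtain t s where t: "runs program (input_state n E p \<alpha>) t s" "t \<le> unit_cost * work" "accepts s \<longleftrightarrow> all_trees_ok"
    by (rule run_program)
  have "1 \<le> unit_cost" by (simp add: unit_cost_def init_com_def)
  from order_trans[OF of_nat_mono[OF t(2)] work_bound[OF this]] show ?thesis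
    using t decision by (intro exI[of _ t] exI[of _ s]) auto
qed

end

theorem theorem1p3:
  "\<exists>(M :: com) (C :: real). C > 0 \<and>
     (\<forall>(n :: nat) (E :: nat set set) (p :: nat \<Rightarrow> real) (\<alpha> :: real).
        n \<ge> 1 \<and> simple_graph {..<n} E \<and> (\<forall>v<n. 0 < p v \<and> p v < 1) \<and> 0 < \<alpha> \<and> \<alpha> \<le> 1 \<longrightarrow>
        (\<exists>t s. runs M (input_state n E p \<alpha>) t s \<and>
           real t \<le> time_bound C n (max_degree {..<n} E) \<alpha> \<and>
           (if accepts s
            then p \<in> shearer_region {..<n} E
            else (\<lambda>v. (1 + \<alpha>) * p v) \<notin> shearer_region {..<n} E)))"
proof (rule exI[of _ program], rule exI[of _ "4 * ln (15 * real unit_cost) + 176"], rule conjI)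
  have "1 \<le> unit_cost" by (simp add: unit_cost_def init_com_def)
  then show "0 < 4 * ln (15 * real unit_cost) + 176" by (simp add: add_nonneg_pos)
qed (intro allI impI instance_data.program_correct instance_data.intro, auto)

end
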